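(* Let $G$ act by isometries on a Gromov hyperbolic space $X$, and let $\mu$ be a countable, non-elementary, bounded, WPD probability measure on $G$. Then there are constants $B>0$ and $c<1$ such that for all $n$, $$\mathbb P(w_n\text{ is WPD})\ge 1-Bc^{\sqrt n}.$$
   Context: $X$ is a $\delta$-hyperbolic geodesic metric space, not necessarily proper; basepoint $x$. Loxodromic: $\lim d(x,g^nx)/n>0$. $\mathrm{Stab}_K(y,z)=\{g\in G:d(y,gy)\le K,d(z,gz)\le K\}$; a loxodromic $h$ is WPD if for every $K>0$ and $y\in X$ there is $M$ with $\mathrm{Stab}_K(y,h^My)$ finite. $w_n=g_1\cdots g_n$, $g_i$ i.i.d. $\sim\mu$; $\Gamma_\mu$ semigroup generated by $\mathrm{supp}\mu$. Countable: countable support; non-elementary: $\Gamma_\mu$ contains two loxodromics with disjoint fixed sets in $\partial X$; bounded: $\{gx:g\in\mathrm{supp}\mu\}$ bounded; WPD: $\Gamma_\mu$ contains an element WPD for the $G$-action. *)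

theory Defs
  imports "HOL-Algebra.Group" "HOL-Probability.Probability"
begin

definition gromov_prod :: "'x::metric_space \<Rightarrow> 'x \<Rightarrow> 'x \<Rightarrow> real" where
  "gromov_prod w y z = (dist w y + dist w z - dist y z) / 2"

definition hyperbolic :: "real \<Rightarrow> 'x::metric_space itself \<Rightarrow> bool" where
  "hyperbolic \<delta> _ \<longleftrightarrow> (\<forall>w y z u :: 'x.
      gromov_prod w y z \<ge> min (gromov_prod w y u) (gromov_prod w u z) - \<delta>)"

definition geodesic_space :: "'x::metric_space itself \<Rightarrow> bool" where
  "geodesic_space _ \<longleftrightarrow> (\<forall>y z :: 'x. \<exists>\<gamma> :: real \<Rightarrow> 'x.
      \<gamma> 0 = y \<and> \<gamma> (dist y z) = z \<and>
      (\<forall>s\<in>{0..dist y z}. \<forall>t\<in>{0..dist y z}. dist (\<gamma> s) (\<gamma> t) = \<bar>s - t\<bar>))"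

text \<open>Sequences converging at infinity and equivalence of such (Gromov boundary = classes).\<close>
definition conv_infty :: "'x::metric_space \<Rightarrow> (nat \<Rightarrow> 'x) \<Rightarrow> bool" where
  "conv_infty x0 s \<longleftrightarrow> (\<forall>K. \<exists>N. \<forall>m\<ge>N. \<forall>n\<ge>N. gromov_prod x0 (s m) (s n) \<ge> K)"

definition bdry_equiv :: "'x::metric_space \<Rightarrow> (nat \<Rightarrow> 'x) \<Rightarrow> (nat \<Rightarrow> 'x) \<Rightarrow> bool" where
  "bdry_equiv x0 s t \<longleftrightarrow> (\<forall>K. \<exists>N. \<forall>m\<ge>N. \<forall>n\<ge>N. gromov_prod x0 (s m) (t n) \<ge> K)"

definition bdry_fixes :: "('g \<Rightarrow> 'x::metric_space \<Rightarrow> 'x) \<Rightarrow> 'x \<Rightarrow> 'g \<Rightarrow> (nat \<Rightarrow> 'x) \<Rightarrow> bool" where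
  "bdry_fixes act x0 g s \<longleftrightarrow> bdry_equiv x0 (\<lambda>n. act g (s n)) s"

definition isometric_action ::
  "('g, 'b) monoid_scheme \<Rightarrow> ('g \<Rightarrow> 'x::metric_space \<Rightarrow> 'x) \<Rightarrow> bool" where
  "isometric_action G act \<longleftrightarrow>
     (\<forall>y. act \<one>\<^bsub>G\<^esub> y = y) \<and>
     (\<forall>g\<in>carrier G. \<forall>h\<in>carrier G. \<forall>y. act (g \<otimes>\<^bsub>G\<^esub> h) y = act g (act h y)) \<and>
     (\<forall>g\<in>carrier G. \<forall>y z. dist (act g y) (act g z) = dist y z)"

definition loxodromic ::
  "('g, 'b) monoid_scheme \<Rightarrow> ('g \<Rightarrow> 'x::metric_space \<Rightarrow> 'x) \<Rightarrow> 'x \<Rightarrow> 'g \<Rightarrow> bool" where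
  "loxodromic G act x0 g \<longleftrightarrow> g \<in> carrier G \<and>
     (\<exists>l>0. (\<lambda>n. dist x0 (act (g [^]\<^bsub>G\<^esub> n) x0) / real n) \<longlonglongrightarrow> l)"

definition Stab ::
  "('g, 'b) monoid_scheme \<Rightarrow> ('g \<Rightarrow> 'x::metric_space \<Rightarrow> 'x) \<Rightarrow> real \<Rightarrow> 'x \<Rightarrow> 'x \<Rightarrow> 'g set" where
  "Stab G act K y z = {g \<in> carrier G. dist y (act g y) \<le> K \<and> dist z (act g z) \<le> K}"

definition WPD ::
  "('g, 'b) monoid_scheme \<Rightarrow> ('g \<Rightarrow> 'x::metric_space \<Rightarrow> 'x) \<Rightarrow> 'x \<Rightarrow> 'g \<Rightarrow> bool" where
  "WPD G act x0 h \<longleftrightarrow> loxodromic G act x0 h \<and>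
     (\<forall>K>0. \<forall>y. \<exists>M::nat. finite (Stab G act K y (act (h [^]\<^bsub>G\<^esub> M) y)))"

inductive_set gen_semigroup :: "('g, 'b) monoid_scheme \<Rightarrow> 'g set \<Rightarrow> 'g set"
  for G S where
    base: "s \<in> S \<Longrightarrow> s \<in> gen_semigroup G S"
  | mult: "a \<in> gen_semigroup G S \<Longrightarrow> b \<in> gen_semigroup G S \<Longrightarrow> a \<otimes>\<^bsub>G\<^esub> b \<in> gen_semigroup G S"

text \<open>Distribution of w_n = g_1 ... g_n with g_i i.i.d. of law mu (n-fold convolution).\<close>
primrec walk_dist :: "('g, 'b) monoid_scheme \<Rightarrow> 'g pmf \<Rightarrow> nat \<Rightarrow> 'g pmf" where
  "walk_dist G \<mu> 0 = return_pmf \<one>\<^bsub>G\<^esub>"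
| "walk_dist G \<mu> (Suc n) = bind_pmf (walk_dist G \<mu> n) (\<lambda>w. map_pmf (\<lambda>g. w \<otimes>\<^bsub>G\<^esub> g) \<mu>)"

definition non_elementary ::
  "('g, 'b) monoid_scheme \<Rightarrow> ('g \<Rightarrow> 'x::metric_space \<Rightarrow> 'x) \<Rightarrow> 'x \<Rightarrow> 'g pmf \<Rightarrow> bool" where
  "non_elementary G act x0 \<mu> \<longleftrightarrow>
     (\<exists>g\<in>gen_semigroup G (set_pmf \<mu>). \<exists>h\<in>gen_semigroup G (set_pmf \<mu>).
        loxodromic G act x0 g \<and> loxodromic G act x0 h \<and>
        \<not> (\<exists>s. conv_infty x0 s \<and> bdry_fixes act x0 g s \<and> bdry_fixes act x0 h s))"

definition bounded_meas ::
  "('g \<Rightarrow> 'x::metric_space \<Rightarrow> 'x) \<Rightarrow> 'x \<Rightarrow> 'g pmf \<Rightarrow> bool" where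
  "bounded_meas act x0 \<mu> \<longleftrightarrow> bounded ((\<lambda>g. act g x0) ` set_pmf \<mu>)"

definition WPD_meas ::
  "('g, 'b) monoid_scheme \<Rightarrow> ('g \<Rightarrow> 'x::metric_space \<Rightarrow> 'x) \<Rightarrow> 'x \<Rightarrow> 'g pmf \<Rightarrow> bool" where
  "WPD_meas G act x0 \<mu> \<longleftrightarrow> (\<exists>h\<in>gen_semigroup G (set_pmf \<mu>). WPD G act x0 h)"

end

theory Submission
  imports Defs "HOL-Real_Asymp.Real_Asymp"
begin

text \<open>
Two independent loxodromic elements of the semigroup yield elements \<open>a\<close>, \<open>b\<close> of equal word
length playing ping-pong, so that the inverses of words in \<open>a\<close>, \<open>b\<close> move any point to many
uniformly separated positions. A maximum principle then makes every deep shadow and, eventually, every ball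
improbable for the walk, uniformly in the point or centre. Applied to both the walk and its inverse, this
gives linear growth of the expected displacement, then a drift away from every point in expectation, and,
as the steps are bounded, exponential decay of the probability that the walk does not move away from a
given point.

Let \<open>f\<close> be a power of the WPD element so long that few elements move both ends of \<open>[x, f x]\<close>
by a bounded amount. In a block \<open>A f B\<close> with \<open>A\<close>, \<open>B\<close> of length about \<open>\<surd>n\<close>, the path
through \<open>A x\<close> and \<open>A f x\<close> has with positive probability no backtracking near \<open>f\<close>, and
except with probability exponentially small in \<open>\<surd>n\<close> the rest of the (cyclic) word does not
change this. Then \<open>w_n\<close> is conjugate to \<open>f v\<close> whose powers follow a broken quasi-geodesic through
translates of \<open>[x, f x]\<close>, hence \<open>w_n\<close> is WPD. There are about \<open>\<surd>n\<close> disjoint blocks, and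
all of them fail with probability exponentially small in \<open>\<surd>n\<close>.
\<close>

section \<open>Gromov products and isometric actions\<close>

text \<open>Non-concentration is proved at finite times, from finitely many atoms of one convolution
  power, with constants uniform in the point \<open>z\<close>. This uniformity is what permits
  conditioning on part of a word: the conditioned part only changes the point from which the
  remaining letters are viewed.

  The obstacle at the end is that the junctions of a block depend on the whole cyclic word. They are
  split into a local condition on \<open>A\<close>, \<open>f\<close>, \<open>B\<close>, of
  probability bounded below, and two interference events whose probability decays with the block
  length. A locally bad block is absorbed into a left factor of the remaining word, so the estimate
  has to be uniform over all left factors.

  The order of choices matters: the shadow depth \<open>R\<close> comes from the walk alone, the
  power of the WPD element is long relative to \<open>R\<close>, and only the block length varies
  with \<open>n\<close>.\<close>

lemma gromov_prod_commute: "gromov_prod w y z = gromov_prod w z y"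
  by (simp add: gromov_prod_def dist_commute)

lemma gromov_prod_nonneg: "0 \<le> gromov_prod w y z"
  using dist_triangle[of y z w] by (simp add: gromov_prod_def dist_commute)

lemma gromov_prod_le_left: "gromov_prod w y z \<le> dist w y"
  using dist_triangle[of w z y] by (simp add: gromov_prod_def)

lemma gromov_prod_le_right: "gromov_prod w y z \<le> dist w z"
  using gromov_prod_le_left[of w z y] by (simp add: gromov_prod_commute)

lemma gromov_prod_flip: "gromov_prod w y z = dist w y - gromov_prod y w z"
  by (simp add: gromov_prod_def dist_commute field_simps)

lemma gromov_prod_same: "gromov_prod w y y = dist w y"
  by (simp add: gromov_prod_def)

lemma gromov_prod_refl_left: "gromov_prod w w z = 0"
  by (simp add: gromov_prod_def)

lemma gromov_prod_refl_right: "gromov_prod w z w = 0"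
  by (simp add: gromov_prod_def dist_commute)

lemma gromov_prod_move_base: "gromov_prod w y z \<le> gromov_prod w' y z + dist w w'"
  using dist_triangle[of w y w'] dist_triangle[of w z w'] by (simp add: gromov_prod_def field_simps)

lemma gromov_prod_move_right: "gromov_prod w y z \<le> gromov_prod w y z' + dist z z'"
  using dist_triangle[of w z z'] dist_triangle[of y z' z]
  by (simp add: gromov_prod_def dist_commute field_simps)

lemma gromov_prod_move_left: "gromov_prod w y z \<le> gromov_prod w y' z + dist y y'"
  using gromov_prod_move_right[of w z y y'] by (simp add: gromov_prod_commute)

locale hyp_action = group G for G :: "('g, 'b) monoid_scheme" (structure) +
  fixes act :: "'g \<Rightarrow> 'x::metric_space \<Rightarrow> 'x" and x0 :: 'x and \<delta> :: real
  assumes hyp: "hyperbolic \<delta> TYPE('x)"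
    and isom: "isometric_action G act"
begin

lemma hyp_min: "min (gromov_prod w y u) (gromov_prod w u z) - \<delta> \<le> gromov_prod w y (z::'x)"
  using hyp by (simp add: hyperbolic_def)

lemma \<delta>_nonneg: "0 \<le> \<delta>"
  using hyp_min[of x0 x0 x0 x0] by (simp add: gromov_prod_def)

text \<open>The product inequality read contrapositively: seen from \<open>w\<close>, a point may be
  exchanged for one deep in the same direction at the price of \<delta>. Most replacements of
  endpoints are this step or its mirror image.\<close>

lemma hyp_le_left:
  assumes "gromov_prod w y z \<le> R" "R + \<delta> < gromov_prod w u (z::'x)"
  shows "gromov_prod w y u \<le> R + \<delta>"
  using hyp_min[of w y u z] assms by (auto simp: min_def split: if_splits)

lemma hyp_le_right:
  assumes "gromov_prod w y z \<le> R" "R + \<delta> < gromov_prod w y (u::'x)"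
  shows "gromov_prod w u z \<le> R + \<delta>"
  using hyp_min[of w y u z] assms by (auto simp: min_def split: if_splits)

lemma four_point:
  "dist x y + dist z w \<le> max (dist x z + dist y w) (dist x w + dist y (z::'x)) + 2 * \<delta>"
proof -
  have "min (gromov_prod w x z) (gromov_prod w z y) - \<delta> \<le> gromov_prod w x y"
    by (rule hyp_min)
  then show ?thesis
    by (auto simp: gromov_prod_def dist_commute min_def max_def field_simps split: if_splits)
qed

text \<open>Both sums on the right of \<open>four_point\<close> are at most
  \<open>dist x y + 2 * C + K\<close>, and \<open>dist x y\<close> cancels.\<close>

lemma near_geodesic_close:
  assumes "gromov_prod p x y \<le> C" "dist x p' \<le> dist x p + K" "dist y p' \<le> dist y (p::'x) + K"
  shows "dist p p' \<le> K + 2 * C + 2 * \<delta>"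
proof -
  have "dist x y + dist p p' \<le> max (dist x p + dist y p') (dist x p' + dist y p) + 2 * \<delta>"
    by (rule four_point)
  moreover have "dist p x + dist p y \<le> dist x y + 2 * C"
    using assms(1) by (simp add: gromov_prod_def)
  ultimately show ?thesis using assms(2,3) by (simp add: dist_commute max_def split: if_splits)
qed

section \<open>Local-to-global principle for broken paths\<close>

text \<open>Flipping the product along a long edge makes it exceed \<open>R + \<delta>\<close> at
  the far end, so the previous vertex can be exchanged for \<open>p 0\<close>. Errors do not
  accumulate, since every step restarts from the corner bound \<open>R\<close>; the summand 1 in the
  edge length gives the progress.\<close>

lemma chain_forward:
  fixes p :: "nat \<Rightarrow> 'x"
  assumes R: "\<And>i. gromov_prod (p (Suc i)) (p i) (p (Suc (Suc i))) \<le> R"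
    and d: "\<And>i. 2 * R + 10 * \<delta> + 1 \<le> dist (p i) (p (Suc i))" and "0 \<le> R"
  shows "gromov_prod (p (Suc k)) (p 0) (p (Suc (Suc k))) \<le> R + \<delta> \<and>
         dist (p 0) (p (Suc k)) + 1 \<le> dist (p 0) (p (Suc (Suc k)))"
proof (induction k)
  case 0
  then show ?case using R[of 0] d[of 1] \<delta>_nonneg by (auto simp: gromov_prod_def dist_commute)
next
  case (Suc k)
  let ?w = "p (Suc (Suc k))" and ?z = "p (Suc (Suc (Suc k)))"
  have "gromov_prod ?w (p (Suc k)) (p 0) = dist ?w (p (Suc k)) - gromov_prod (p (Suc k)) ?w (p 0)"
    by (rule gromov_prod_flip)
  also have "\<dots> \<ge> R + 9 * \<delta> + 1"
    using Suc d[of "Suc k"] by (simp add: gromov_prod_commute dist_commute)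
  finally have "R + \<delta> < gromov_prod ?w (p (Suc k)) (p 0)" using \<delta>_nonneg by linarith
  then have *: "gromov_prod ?w (p 0) ?z \<le> R + \<delta>" using R[of "Suc k"] hyp_le_right by blast
  moreover have "dist (p 0) ?w + 1 \<le> dist (p 0) ?z"
    using * d[of "Suc (Suc k)"] \<delta>_nonneg by (simp add: gromov_prod_def dist_commute field_simps)
  ultimately show ?case by simp
qed

lemma chain_backward:
  fixes p :: "nat \<Rightarrow> 'x"
  assumes R: "\<And>i. gromov_prod (p (Suc i)) (p i) (p (Suc (Suc i))) \<le> R"
    and d: "\<And>i. 2 * R + 10 * \<delta> + 1 \<le> dist (p i) (p (Suc i))" and "0 \<le> R"
  shows "gromov_prod (p (Suc j)) (p j) (p (Suc (Suc (j + k)))) \<le> R + \<delta>"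
proof (induction k arbitrary: j)
  case 0
  then show ?case using R[of j] \<delta>_nonneg by simp
next
  case (Suc k)
  let ?w = "p (Suc j)" and ?z = "p (Suc (Suc (j + Suc k)))"
  have "gromov_prod ?w (p (Suc (Suc j))) ?z
      = dist ?w (p (Suc (Suc j))) - gromov_prod (p (Suc (Suc j))) ?w ?z"
    by (rule gromov_prod_flip)
  also have "\<dots> \<ge> R + 9 * \<delta> + 1"
    using Suc[of "Suc j"] d[of "Suc j"] by (simp add: gromov_prod_commute dist_commute)
  finally have "R + \<delta> < gromov_prod ?w (p (Suc (Suc j))) ?z" using \<delta>_nonneg by linarith
  then show ?case using R[of j] hyp_le_left[of ?w "p j" "p (Suc (Suc j))" R ?z]
    by (smt (verit) gromov_prod_commute hyp_le_right)
qed

lemma chain_dist: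
  fixes p :: "nat \<Rightarrow> 'x"
  assumes R: "\<And>i. gromov_prod (p (Suc i)) (p i) (p (Suc (Suc i))) \<le> R"
    and d: "\<And>i. 2 * R + 10 * \<delta> + 1 \<le> dist (p i) (p (Suc i))" and "0 \<le> R"
  shows "real k \<le> dist (p j) (p (j + k))"
proof (induction k)
  case 0
  then show ?case by simp
next
  case (Suc k)
  show ?case
  proof (cases k)
    case 0
    then show ?thesis using d[of j] \<open>0 \<le> R\<close> \<delta>_nonneg by simp
  next
    case (Suc l)
    with chain_forward[of "\<lambda>i. p (j + i)" R l] R d \<open>0 \<le> R\<close> Suc.IH show ?thesis by simp
  qed
qed

text \<open>Forward chaining controls the past of \<open>p j\<close>; backward chaining allows the
  next vertex to be exchanged for \<open>p k\<close>. Each costs one \<delta>, whatever the number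
  of vertices.\<close>

lemma chain_gromov_prod:
  fixes p :: "nat \<Rightarrow> 'x"
  assumes R: "\<And>i. gromov_prod (p (Suc i)) (p i) (p (Suc (Suc i))) \<le> R"
    and d: "\<And>i. 2 * R + 10 * \<delta> + 1 \<le> dist (p i) (p (Suc i))" and "0 \<le> R"
    and "i \<le> j" "j \<le> k"
  shows "gromov_prod (p j) (p i) (p k) \<le> R + 2 * \<delta>"
proof (cases "i = j \<or> j = k")
  case True
  then show ?thesis using \<open>0 \<le> R\<close> \<delta>_nonneg
    by (auto simp: gromov_prod_refl_left gromov_prod_refl_right)
next
  case False
  define m where "m = j - Suc i"
  define l where "l = k - Suc j"
  have j: "j = Suc (i + m)" and k: "k = Suc (j + l)" using False assms(4,5) by (auto simp: m_def l_def)
  have 1: "gromov_prod (p j) (p i) (p (Suc j)) \<le> R + \<delta>"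
    using chain_forward[of "\<lambda>n. p (i + n)" R m] R d \<open>0 \<le> R\<close> by (simp add: j)
  show ?thesis
  proof (cases l)
    case 0
    then show ?thesis using 1 k \<delta>_nonneg by simp
  next
    case (Suc l')
    have 2: "gromov_prod (p (Suc j)) (p j) (p k) \<le> R + \<delta>"
      using chain_backward[of p R j l'] R d \<open>0 \<le> R\<close> by (simp add: k Suc)
    have "gromov_prod (p j) (p (Suc j)) (p k) = dist (p j) (p (Suc j)) - gromov_prod (p (Suc j)) (p j) (p k)"
      by (rule gromov_prod_flip)
    also have "\<dots> \<ge> R + 9 * \<delta> + 1" using 2 d[of j] by simp
    finally have "(R + \<delta>) + \<delta> < gromov_prod (p j) (p k) (p (Suc j))"
      using \<delta>_nonneg by (simp add: gromov_prod_commute)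
    from hyp_le_left[OF 1 this] show ?thesis by simp
  qed
qed

section \<open>Isometries and displacement of the basepoint\<close>

lemma act_one [simp]: "act \<one> y = y"
  using isom by (simp add: isometric_action_def)

lemma act_mult: "g \<in> carrier G \<Longrightarrow> h \<in> carrier G \<Longrightarrow> act (g \<otimes> h) y = act g (act h y)"
  using isom by (simp add: isometric_action_def)

lemma act_dist [simp]: "g \<in> carrier G \<Longrightarrow> dist (act g y) (act g z) = dist y z"
  using isom by (simp add: isometric_action_def)

lemma act_inv_act [simp]: "g \<in> carrier G \<Longrightarrow> act (inv g) (act g y) = y"
  using act_mult[of "inv g" g y] by simp

lemma act_act_inv [simp]: "g \<in> carrier G \<Longrightarrow> act g (act (inv g) y) = y"
  using act_mult[of g "inv g" y] by simp

lemma dist_act_inv: "g \<in> carrier G \<Longrightarrow> dist y (act (inv g) z) = dist (act g y) z"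
  using act_dist[of g y "act (inv g) z"] by simp

lemma act_gromov_prod [simp]:
  "g \<in> carrier G \<Longrightarrow> gromov_prod (act g w) (act g y) (act g z) = gromov_prod w y z"
  by (simp add: gromov_prod_def)

lemma gromov_prod_act_inv:
  "g \<in> carrier G \<Longrightarrow> gromov_prod w (act (inv g) y) z = gromov_prod (act g w) y (act g z)"
  using act_gromov_prod[of g w "act (inv g) y" z] by simp

definition len :: "'g \<Rightarrow> real" where "len g = dist x0 (act g x0)"

lemma len_nonneg [simp]: "0 \<le> len g" by (simp add: len_def)

lemma len_one [simp]: "len \<one> = 0" by (simp add: len_def)

lemma len_inv [simp]: "g \<in> carrier G \<Longrightarrow> len (inv g) = len g"
  by (simp add: len_def dist_act_inv dist_commute)

lemma len_mult: "g \<in> carrier G \<Longrightarrow> h \<in> carrier G \<Longrightarrow> len (g \<otimes> h) \<le> len g + len h"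
  using dist_triangle[of x0 "act (g \<otimes> h) x0" "act g x0"] by (simp add: len_def act_mult)

text \<open>The ping-pong configuration: the images of \<open>x0\<close> under \<open>a\<close>,
  \<open>b\<close> and their inverses lie in pairwise different directions, up to \<open>C\<close>,
  and at distance at least \<open>D\<close>. It is useful when \<open>D\<close> is large relative to
  \<open>C\<close>.\<close>

definition schottky_pair :: "real \<Rightarrow> real \<Rightarrow> 'g \<Rightarrow> 'g \<Rightarrow> bool" where
  "schottky_pair C D a b \<longleftrightarrow> D \<le> len a \<and> D \<le> len b
      \<and> gromov_prod x0 (act a x0) (act (inv a) x0) \<le> C
      \<and> gromov_prod x0 (act b x0) (act (inv b) x0) \<le> C
      \<and> (\<forall>u\<in>{a, inv a}. \<forall>v\<in>{b, inv b}. gromov_prod x0 (act u x0) (act v x0) \<le> C)"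

lemma schottky_pair_inv:
  "a \<in> carrier G \<Longrightarrow> b \<in> carrier G \<Longrightarrow> schottky_pair C D (inv a) (inv b) \<longleftrightarrow> schottky_pair C D a b"
  by (auto simp: schottky_pair_def gromov_prod_commute)

lemma len_pow: "g \<in> carrier G \<Longrightarrow> len (g [^] n) \<le> real n * len g"
proof (induction n)
  case (Suc n)
  then show ?case using len_mult[of "g [^] n" g] by (simp add: algebra_simps)
qed simp

lemma act_pow_add:
  "g \<in> carrier G \<Longrightarrow> act (g [^] (m + n)) y = act (g [^] (m::nat)) (act (g [^] (n::nat)) y)"
  by (simp add: nat_pow_mult[symmetric] act_mult)

lemma dist_pow:
  assumes "g \<in> carrier G" "m \<le> n"
  shows "dist (act (g [^] m) x0) (act (g [^] n) x0) = len (g [^] (n - m :: nat))"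
  using act_pow_add[OF assms(1), of m "n - m" x0] assms by (simp add: len_def)

end

section \<open>Loxodromic elements\<close>

lemma subadditive_mult_le:
  fixes a :: "nat \<Rightarrow> real"
  assumes "\<And>m n. a (m + n) \<le> a m + a n" "a 0 = 0"
  shows "a (q * n) \<le> real q * a n"
proof (induction q)
  case (Suc q)
  then show ?case using assms(1)[of n "q * n"] by (simp add: algebra_simps)
qed (simp add: assms)

text \<open>Fekete's lemma. \<open>loxodromic\<close> asks for a limit, which a linear lower bound
  on displacements alone does not supply.\<close>

lemma subadditive_convergent:
  fixes a :: "nat \<Rightarrow> real"
  assumes sub: "\<And>m n. a (m + n) \<le> a m + a n" and a0: "a 0 = 0" and nn: "\<And>n. 0 \<le> a n"
  shows "\<exists>l. (\<lambda>n. a n / real n) \<longlonglongrightarrow> l"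
proof
  define l where "l = (INF n\<in>{1..}. a n / real n)"
  have bdd: "bdd_below ((\<lambda>n. a n / real n) ` {1..})"
    by (rule bdd_belowI[of _ 0]) (auto simp: nn)
  have lower: "l \<le> a n / real n" if "n \<ge> 1" for n
    unfolding l_def using that by (intro cINF_lower[OF bdd]) auto
  show "(\<lambda>n. a n / real n) \<longlonglongrightarrow> l"
  proof (rule LIMSEQ_I)
    fix e :: real assume e: "0 < e"
    have "\<exists>N\<in>{1..}. a N / real N < l + e / 2"
      using e by (subst cINF_less_iff[OF _ bdd, symmetric]) (auto simp: l_def)
    then obtain N where N: "N \<ge> 1" "a N / real N < l + e / 2" by auto
    obtain n0 where n0: "real n0 > 2 * (real N * a 1) / e" using reals_Archimedean2 by blast
    show "\<exists>no. \<forall>n\<ge>no. norm (a n / real n - l) < e"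
    proof (intro exI allI impI)
      fix n assume n: "n \<ge> Suc n0"
      then have npos: "0 < real n" by simp
      have "a n \<le> a (n div N * N) + a (n mod N)" using sub[of "n div N * N" "n mod N"] by simp
      also have "\<dots> \<le> real (n div N) * a N + real (n mod N) * a 1"
        using subadditive_mult_le[OF sub a0, of "n div N" N] subadditive_mult_le[OF sub a0, of "n mod N" 1]
        by simp
      also have "\<dots> \<le> real n / real N * a N + real N * a 1"
      proof (intro add_mono mult_right_mono nn)
        show "real (n div N) \<le> real n / real N" by (simp add: of_nat_div_le_of_nat)
        have "n mod N < N" using N by simp
        then show "real (n mod N) \<le> real N" by simp
      qed
      finally have "a n / real n \<le> a N / real N + real N * a 1 / real n"
        using npos by (simp add: field_simps)
      moreover have "real N * a 1 / real n < e / 2"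
      proof -
        have "2 * (real N * a 1) / e < real n" using n0 n by linarith
        then show ?thesis using e npos by (simp add: field_simps)
      qed
      ultimately have "a n / real n < l + e" using N(2) by linarith
      moreover have "l \<le> a n / real n" using lower n by simp
      ultimately show "norm (a n / real n - l) < e" by simp
    qed
  qed
qed

context hyp_action
begin

lemma loxodromic_carrier: "loxodromic G act x0 g \<Longrightarrow> g \<in> carrier G"
  by (simp add: loxodromic_def)

lemma loxodromic_len:
  assumes "loxodromic G act x0 g"
  shows "\<exists>l>0. \<exists>N::nat. \<forall>n\<ge>N. l * real n \<le> len (g [^] n)"
proof -
  obtain l where l: "l > 0" "(\<lambda>n. len (g [^] n) / real n) \<longlonglongrightarrow> l"
    using assms by (auto simp: loxodromic_def len_def)
  then have "\<forall>\<^sub>F n in sequentially. l / 2 < len (g [^] n) / real n"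
    by (intro order_tendstoD) auto
  then obtain N where N: "\<forall>n\<ge>N. l / 2 < len (g [^] n) / real n"
    by (auto simp: eventually_sequentially)
  show ?thesis
  proof (intro exI[of _ "l / 2"] conjI exI[of _ "Suc N"] allI impI)
    fix n assume "Suc N \<le> n"
    with N have "l / 2 < len (g [^] n) / real n" and "0 < real n" by auto
    then show "l / 2 * real n \<le> len (g [^] n)" by (simp add: field_simps)
  qed (use l in simp)
qed

lemma loxodromic_len_unbounded:
  assumes "loxodromic G act x0 g"
  shows "\<exists>N::nat. \<forall>n\<ge>N. D \<le> len (g [^] n)"
proof -
  obtain l and N :: nat where l: "l > 0" and N: "\<And>n. n \<ge> N \<Longrightarrow> l * real n \<le> len (g [^] n)"
    using loxodromic_len[OF assms] by blast
  obtain k where k: "D / l < real k" using reals_Archimedean2 by blast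
  show ?thesis
  proof (intro exI[of _ "max N k"] allI impI)
    fix n assume n: "max N k \<le> n"
    then have "D / l < real n" using k by linarith
    then have "D \<le> l * real n" using l by (simp add: field_simps)
    with N[of n] n show "D \<le> len (g [^] n)" by simp
  qed
qed

lemma loxodromic_inv:
  assumes "loxodromic G act x0 g"
  shows "loxodromic G act x0 (inv g)"
proof -
  have g: "g \<in> carrier G" using assms by (rule loxodromic_carrier)
  have "len (inv g [^] n) = len (g [^] n)" for n :: nat
    using g by (simp add: nat_pow_inv)
  then show ?thesis using assms g by (simp add: loxodromic_def len_def)
qed

text \<open>Otherwise each squaring would add less than \<open>c\<close>, so displacement would be
  at most linear in \<open>k\<close> along the powers \<open>2 ^ k\<close>, against its linear
  growth in the exponent itself.\<close>

lemma loxodromic_doubling: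
  assumes "loxodromic G act x0 g"
  shows "\<exists>N::nat\<ge>1. len (g [^] N) + c \<le> len (g [^] (2 * N))"
proof (rule ccontr)
  assume contra: "\<not> ?thesis"
  have *: "len (g [^] (2 ^ k :: nat)) \<le> len g + real k * c" for k
  proof (induction k)
    case 0
    then show ?case using loxodromic_carrier[OF assms] by simp
  next
    case (Suc k)
    have "len (g [^] (2 * 2 ^ k :: nat)) < len (g [^] (2 ^ k :: nat)) + c"
      using contra by (meson not_le one_le_numeral one_le_power)
    then show ?case using Suc by (simp add: algebra_simps)
  qed
  obtain l and N :: nat where l: "l > 0" and N: "\<And>n. n \<ge> N \<Longrightarrow> l * real n \<le> len (g [^] n)"
    using loxodromic_len[OF assms] by blast
  have "\<forall>\<^sub>F k in sequentially. len g + real k * c < l * 2 ^ k"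
  proof -
    have "(\<lambda>k. real k / 2 ^ k) \<longlonglongrightarrow> 0" "(\<lambda>k. 1 / 2 ^ k :: real) \<longlonglongrightarrow> 0"
      by real_asymp+
    then have "(\<lambda>k. len g * (1 / 2 ^ k) + c * (real k / 2 ^ k)) \<longlonglongrightarrow> len g * 0 + c * 0"
      by (intro tendsto_intros)
    then have "\<forall>\<^sub>F k in sequentially. len g * (1 / 2 ^ k) + c * (real k / 2 ^ k) < l"
      using l by (intro order_tendstoD) auto
    then show ?thesis by eventually_elim (simp add: field_simps)
  qed
  moreover have "\<forall>\<^sub>F k in sequentially. N \<le> k" by (rule eventually_ge_at_top)
  ultimately have "\<forall>\<^sub>F k in sequentially. len g + real k * c < l * 2 ^ k \<and> N \<le> k"
    by (rule eventually_conj)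
  then obtain k where k: "len g + real k * c < l * 2 ^ k" "N \<le> k"
    by (auto simp: eventually_sequentially)
  have "k \<le> 2 ^ k" by (simp add: less_imp_le)
  with k N[of "2 ^ k"] *[of k] show False by simp
qed

text \<open>Sampling the orbit every \<open>N\<close> steps, with \<open>N\<close> from
  \<open>loxodromic_doubling\<close>, meets the hypotheses of the chain lemmas; the points in
  between stay at bounded distance from the samples.\<close>

lemma loxodromic_quasi_geodesic:
  assumes "loxodromic G act x0 g"
  shows "\<exists>C. \<forall>i j k :: nat. i \<le> j \<longrightarrow> j \<le> k \<longrightarrow>
           gromov_prod (act (g [^] j) x0) (act (g [^] i) x0) (act (g [^] k) x0) \<le> C"
proof -
  have g: "g \<in> carrier G" using assms by (rule loxodromic_carrier)
  obtain N :: nat where N: "N \<ge> 1" "len (g [^] N) + (10 * \<delta> + 1) \<le> len (g [^] (2 * N))"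
    using loxodromic_doubling[OF assms] by blast
  \<comment> \<open>Exactly the Gromov product at each corner of the sampled orbit, so the doubling
    estimate turns into the edge condition
    \<open>2 * R + 10 * \<delta> + 1 \<le> len (g [^] N)\<close>.\<close>
  define R where "R = len (g [^] N) - len (g [^] (2 * N)) / 2"
  define p where "p = (\<lambda>i. act (g [^] (N * i)) x0)"
  define E where "E = real N * len g"
  have d: "dist (p i) (p (Suc i)) = len (g [^] N)" for i
    using g by (simp add: p_def dist_pow)
  have d2: "dist (p i) (p (Suc (Suc i))) = len (g [^] (2 * N))" for i
  proof -
    have "N * Suc (Suc i) = N * i + 2 * N" by simp
    then show ?thesis
      unfolding p_def using dist_pow[OF g, of "N * i" "N * Suc (Suc i)"] by (simp only: le_add1 add_diff_cancel_left')
  qed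
  have R: "gromov_prod (p (Suc i)) (p i) (p (Suc (Suc i))) = R" for i
    using d[of i] d[of "Suc i"] d2[of i]
    by (simp add: gromov_prod_def R_def dist_commute diff_divide_distrib)
  have chain: "gromov_prod (p j) (p i) (p k) \<le> R + 2 * \<delta>" if "i \<le> j" "j \<le> k" for i j k
  proof (rule chain_gromov_prod[OF _ _ _ that])
    show "0 \<le> R" using gromov_prod_nonneg R[of 0] by metis
    show "2 * R + 10 * \<delta> + 1 \<le> dist (p i) (p (Suc i))" for i
      using N(2) by (simp add: d R_def)
  qed (simp add: R)
  have E: "dist (act (g [^] i) x0) (p (i div N)) \<le> E" for i
  proof -
    have "dist (act (g [^] i) x0) (p (i div N)) = len (g [^] (i mod N))"
      using g dist_pow[of g "N * (i div N)" i]
      by (simp add: p_def dist_commute minus_mult_div_eq_mod)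
    also have "\<dots> \<le> real (i mod N) * len g" using g by (rule len_pow)
    also have "\<dots> \<le> E" unfolding E_def using N(1) by (intro mult_right_mono) (auto simp: less_imp_le)
    finally show ?thesis .
  qed
  show ?thesis
  proof (intro exI allI impI)
    fix i j k :: nat assume ij: "i \<le> j" "j \<le> k"
    have "gromov_prod (act (g [^] j) x0) (act (g [^] i) x0) (act (g [^] k) x0)
        \<le> gromov_prod (p (j div N)) (act (g [^] i) x0) (act (g [^] k) x0) + E"
      using gromov_prod_move_base E[of j] by (smt (verit))
    also have "\<dots> \<le> gromov_prod (p (j div N)) (p (i div N)) (act (g [^] k) x0) + 2 * E"
      using gromov_prod_move_left[of "p (j div N)" "act (g [^] i) x0"] E[of i] by (smt (verit))
    also have "\<dots> \<le> gromov_prod (p (j div N)) (p (i div N)) (p (k div N)) + 3 * E"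
      using gromov_prod_move_right[of "p (j div N)" "p (i div N)" "act (g [^] k) x0"] E[of k] by (smt (verit))
    also have "\<dots> \<le> R + 2 * \<delta> + 3 * E" using chain ij by (simp add: div_le_mono)
    finally show "gromov_prod (act (g [^] j) x0) (act (g [^] i) x0) (act (g [^] k) x0)
        \<le> R + 2 * \<delta> + 3 * E" .
  qed
qed

lemma loxodromic_gromov_prod_pow_inv:
  assumes "loxodromic G act x0 g"
  shows "\<exists>C. \<forall>(n::nat) (m::nat). gromov_prod x0 (act (g [^] n) x0) (act (inv g [^] m) x0) \<le> C"
proof -
  have g: "g \<in> carrier G" using assms by (rule loxodromic_carrier)
  obtain C where C: "\<And>i j k :: nat. i \<le> j \<Longrightarrow> j \<le> k \<Longrightarrow>
           gromov_prod (act (g [^] j) x0) (act (g [^] i) x0) (act (g [^] k) x0) \<le> C"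
    using loxodromic_quasi_geodesic[OF assms] by blast
  show ?thesis
  proof (intro exI allI)
    fix n m :: nat
    have "gromov_prod x0 (act (g [^] n) x0) (act (inv g [^] m) x0)
      = gromov_prod (act (g [^] m) x0) (act (g [^] m) (act (g [^] n) x0))
          (act (g [^] m) (act (inv (g [^] m)) x0))"
      using g by (simp add: nat_pow_inv[symmetric] del: act_act_inv)
    also have "\<dots> = gromov_prod (act (g [^] m) x0) (act (g [^] (0::nat)) x0) (act (g [^] (m + n)) x0)"
      using g by (simp add: act_pow_add gromov_prod_commute)
    also have "\<dots> \<le> C" by (rule C) auto
    finally show "gromov_prod x0 (act (g [^] n) x0) (act (inv g [^] m) x0) \<le> C" .
  qed
qed

lemma loxodromic_gromov_prod_pow:
  assumes "loxodromic G act x0 g"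
  shows "\<exists>C. \<forall>(n::nat) (m::nat). min (len (g [^] n)) (len (g [^] m)) - C
            \<le> gromov_prod x0 (act (g [^] n) x0) (act (g [^] m) x0)"
proof -
  obtain C where C: "\<And>i j k :: nat. i \<le> j \<Longrightarrow> j \<le> k \<Longrightarrow>
           gromov_prod (act (g [^] j) x0) (act (g [^] i) x0) (act (g [^] k) x0) \<le> C"
    using loxodromic_quasi_geodesic[OF assms] by blast
  have *: "len (g [^] n) - C \<le> gromov_prod x0 (act (g [^] n) x0) (act (g [^] m) x0)"
    if "n \<le> m" for n m :: nat
    using C[of 0 n m] that gromov_prod_flip[of x0 "act (g [^] n) x0" "act (g [^] m) x0"]
    by (simp add: len_def)
  show ?thesis
  proof (intro exI allI)
    fix n m :: nat
    show "min (len (g [^] n)) (len (g [^] m)) - C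
            \<le> gromov_prod x0 (act (g [^] n) x0) (act (g [^] m) x0)"
      using *[of n m] *[of m n] by (cases "n \<le> m") (auto simp: gromov_prod_commute min_def)
  qed
qed

section \<open>Limit points of loxodromic elements and independence\<close>

lemma loxodromic_conv_infty:
  assumes "loxodromic G act x0 g"
  shows "conv_infty x0 (\<lambda>n. act (g [^] n) x0)"
  unfolding conv_infty_def
proof
  fix K
  obtain C where C: "\<And>(n::nat) (m::nat). min (len (g [^] n)) (len (g [^] m)) - C
            \<le> gromov_prod x0 (act (g [^] n) x0) (act (g [^] m) x0)"
    using loxodromic_gromov_prod_pow[OF assms] by blast
  obtain N :: nat where N: "\<forall>n\<ge>N. K + C \<le> len (g [^] n)" using loxodromic_len_unbounded[OF assms] by blast
  show "\<exists>N::nat. \<forall>m\<ge>N. \<forall>n\<ge>N. K \<le> gromov_prod x0 (act (g [^] m) x0) (act (g [^] n) x0)"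
  proof (intro exI[of _ N] allI impI)
    fix m n assume "N \<le> m" "N \<le> n"
    with N have "K + C \<le> len (g [^] m)" "K + C \<le> len (g [^] n)" by auto
    with C[of m n] show "K \<le> gromov_prod x0 (act (g [^] m) x0) (act (g [^] n) x0)"
      by (simp add: min_def split: if_splits)
  qed
qed

text \<open>\<open>w\<close> commutes with the powers of \<open>g\<close>, hence moves every orbit
  point by \<open>len g\<close> and changes products boundedly. The case \<open>inv g\<close> serves
  limit points of powers of inverses.\<close>

lemma loxodromic_bdry_fixes:
  assumes "loxodromic G act x0 g" "w = g \<or> w = inv g"
  shows "bdry_fixes act x0 w (\<lambda>n. act (g [^] n) x0)"
  unfolding bdry_fixes_def bdry_equiv_def
proof
  fix K
  have g: "g \<in> carrier G" using assms by (simp add: loxodromic_carrier)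
  obtain N :: nat where N: "\<forall>m\<ge>N. \<forall>n\<ge>N. K + len g \<le> gromov_prod x0 (act (g [^] m) x0) (act (g [^] n) x0)"
    using loxodromic_conv_infty[OF assms(1)] unfolding conv_infty_def by blast
  have pow: "act (g [^] m) (act g x0) = act g (act (g [^] m) x0)" for m :: nat
    using act_pow_add[OF g, of m 1 x0] act_pow_add[OF g, of 1 m x0] g by simp
  have "dist (act (g [^] m) x0) (act w (act (g [^] m) x0)) = len g" for m :: nat
    using g assms(2) act_dist[of "g [^] m" x0 "act g x0"]
    by (auto simp: dist_act_inv len_def pow dist_commute)
  then have "gromov_prod x0 (act (g [^] m) x0) (act (g [^] n) x0) - len g
     \<le> gromov_prod x0 (act w (act (g [^] m) x0)) (act (g [^] n) x0)" for m n :: nat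
    using gromov_prod_move_left[of x0 "act (g [^] m) x0" "act (g [^] n) x0" "act w (act (g [^] m) x0)"]
    by simp
  then show "\<exists>N::nat. \<forall>m\<ge>N. \<forall>n\<ge>N. K \<le> gromov_prod x0 (act w (act (g [^] m) x0)) (act (g [^] n) x0)"
    using N by (smt (verit))
qed

lemma bdry_fixes_equiv:
  assumes w: "w \<in> carrier G" and st: "bdry_equiv x0 s t" and fx: "bdry_fixes act x0 w t"
  shows "bdry_fixes act x0 w s"
  unfolding bdry_fixes_def bdry_equiv_def
proof
  fix K
  obtain N1 where N1: "\<forall>m\<ge>N1. \<forall>n\<ge>N1. K + len w + 2 * \<delta> \<le> gromov_prod x0 (s m) (t n)"
    using st unfolding bdry_equiv_def by blast
  obtain N2 where N2: "\<forall>m\<ge>N2. \<forall>n\<ge>N2. K + 2 * \<delta> \<le> gromov_prod x0 (act w (t m)) (t n)"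
    using fx unfolding bdry_fixes_def bdry_equiv_def by blast
  show "\<exists>N::nat. \<forall>m\<ge>N. \<forall>n\<ge>N. K \<le> gromov_prod x0 (act w (s m)) (s n)"
  proof (intro exI[of _ "max N1 N2"] allI impI)
    fix m n assume m: "max N1 N2 \<le> m" and n: "max N1 N2 \<le> n"
    have "K + len w + 2 * \<delta> \<le> gromov_prod x0 (s m) (t m)" using N1 m by simp
    also have "\<dots> = gromov_prod (act w x0) (act w (s m)) (act w (t m))" using w by simp
    also have "\<dots> \<le> gromov_prod x0 (act w (s m)) (act w (t m)) + len w"
      using gromov_prod_move_base by (metis dist_commute len_def)
    finally have 1: "K + 2 * \<delta> \<le> gromov_prod x0 (act w (s m)) (act w (t m))" by simp
    have 2: "K + 2 * \<delta> \<le> gromov_prod x0 (act w (t m)) (t n)" using N2 m n by simp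
    have 3: "K + 2 * \<delta> \<le> gromov_prod x0 (t n) (s n)"
      using N1 n by (smt (verit) gromov_prod_commute len_nonneg max.bounded_iff)
    have 4: "min (gromov_prod x0 (act w (s m)) (act w (t m))) (gromov_prod x0 (act w (t m)) (s n)) - \<delta>
        \<le> gromov_prod x0 (act w (s m)) (s n)" by (rule hyp_min)
    have 5: "min (gromov_prod x0 (act w (t m)) (t n)) (gromov_prod x0 (t n) (s n)) - \<delta>
        \<le> gromov_prod x0 (act w (t m)) (s n)" by (rule hyp_min)
    show "K \<le> gromov_prod x0 (act w (s m)) (s n)"
      using 1 2 3 4 5 \<delta>_nonneg by (simp add: min_def split: if_splits)
  qed
qed

text \<open>A single pair of powers with a large product suffices: by quasi-geodesicity all
  sufficiently high powers point in nearly the directions of that pair. Unbounded products would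
  thus make the two orbits equivalent.\<close>

lemma loxodromic_cross_bounded:
  assumes u: "loxodromic G act x0 u" and v: "loxodromic G act x0 v"
    and nf: "\<not> bdry_equiv x0 (\<lambda>n. act (u [^] n) x0) (\<lambda>n. act (v [^] n) x0)"
  shows "\<exists>C. \<forall>(n::nat) (m::nat). gromov_prod x0 (act (u [^] n) x0) (act (v [^] m) x0) \<le> C"
proof (rule ccontr)
  assume contra: "\<not> ?thesis"
  obtain C1 where C1: "\<And>(n::nat) (m::nat). min (len (u [^] n)) (len (u [^] m)) - C1
            \<le> gromov_prod x0 (act (u [^] n) x0) (act (u [^] m) x0)"
    using loxodromic_gromov_prod_pow[OF u] by blast
  obtain C2 where C2: "\<And>(n::nat) (m::nat). min (len (v [^] n)) (len (v [^] m)) - C2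
            \<le> gromov_prod x0 (act (v [^] n) x0) (act (v [^] m) x0)"
    using loxodromic_gromov_prod_pow[OF v] by blast
  define c where "c = \<bar>C1\<bar> + \<bar>C2\<bar> + 2 * \<delta>"
  have "bdry_equiv x0 (\<lambda>n. act (u [^] n) x0) (\<lambda>n. act (v [^] n) x0)"
    unfolding bdry_equiv_def
  proof
    fix K
    obtain n m :: nat where nm: "K + c < gromov_prod x0 (act (u [^] n) x0) (act (v [^] m) x0)"
    proof -
      have "\<not> (\<forall>(n::nat) (m::nat). gromov_prod x0 (act (u [^] n) x0) (act (v [^] m) x0) \<le> K + c)"
        using contra by blast
      then show ?thesis using that by (auto simp: not_le)
    qed
    have lu: "K + c \<le> len (u [^] n)" using nm gromov_prod_le_left[of x0 "act (u [^] n) x0"]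
      unfolding len_def by (smt (verit))
    have lv: "K + c \<le> len (v [^] m)" using nm gromov_prod_le_right[of x0 _ "act (v [^] m) x0"]
      unfolding len_def by (smt (verit))
    obtain N1 :: nat where N1: "\<forall>n\<ge>N1. K + c \<le> len (u [^] n)" using loxodromic_len_unbounded[OF u] by blast
    obtain N2 :: nat where N2: "\<forall>n\<ge>N2. K + c \<le> len (v [^] n)" using loxodromic_len_unbounded[OF v] by blast
    show "\<exists>N::nat. \<forall>k\<ge>N. \<forall>l\<ge>N. K \<le> gromov_prod x0 (act (u [^] k) x0) (act (v [^] l) x0)"
    proof (intro exI[of _ "max N1 N2"] allI impI)
      fix k l assume kl: "max N1 N2 \<le> k" "max N1 N2 \<le> l"
      have "K + c \<le> len (u [^] k)" "K + c \<le> len (v [^] l)" using N1 N2 kl by auto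
      then have 1: "K + c - C1 \<le> gromov_prod x0 (act (u [^] k) x0) (act (u [^] n) x0)"
        and 2: "K + c - C2 \<le> gromov_prod x0 (act (v [^] m) x0) (act (v [^] l) x0)"
        using C1[of k n] C2[of m l] lu lv by (auto simp: min_def split: if_splits)
      have 4: "min (gromov_prod x0 (act (u [^] k) x0) (act (u [^] n) x0))
          (gromov_prod x0 (act (u [^] n) x0) (act (v [^] l) x0)) - \<delta>
        \<le> gromov_prod x0 (act (u [^] k) x0) (act (v [^] l) x0)" by (rule hyp_min)
      have 5: "min (gromov_prod x0 (act (u [^] n) x0) (act (v [^] m) x0))
          (gromov_prod x0 (act (v [^] m) x0) (act (v [^] l) x0)) - \<delta>
        \<le> gromov_prod x0 (act (u [^] n) x0) (act (v [^] l) x0)" by (rule hyp_min)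
      show "K \<le> gromov_prod x0 (act (u [^] k) x0) (act (v [^] l) x0)"
        using nm 1 2 4 5 \<delta>_nonneg unfolding c_def by (simp add: min_def split: if_splits)
    qed
  qed
  with nf show False by simp
qed

lemma independent_cross_bounded:
  assumes g: "loxodromic G act x0 g" and h: "loxodromic G act x0 h"
    and ind: "\<not> (\<exists>s. conv_infty x0 s \<and> bdry_fixes act x0 g s \<and> bdry_fixes act x0 h s)"
    and u: "u = g \<or> u = inv g" and v: "v = h \<or> v = inv h"
  shows "\<exists>C. \<forall>(n::nat) (m::nat). gromov_prod x0 (act (u [^] n) x0) (act (v [^] m) x0) \<le> C"
proof (rule loxodromic_cross_bounded)
  have gh: "g \<in> carrier G" "h \<in> carrier G" using g h by (auto simp: loxodromic_carrier)
  show lu: "loxodromic G act x0 u" and lv: "loxodromic G act x0 v"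
    using g h u v loxodromic_inv by auto
  show "\<not> bdry_equiv x0 (\<lambda>n. act (u [^] n) x0) (\<lambda>n. act (v [^] n) x0)"
  proof
    assume eq: "bdry_equiv x0 (\<lambda>n. act (u [^] n) x0) (\<lambda>n. act (v [^] n) x0)"
    have "bdry_fixes act x0 g (\<lambda>n. act (u [^] n) x0)"
      using loxodromic_bdry_fixes[OF lu, of g] u gh by auto
    moreover have "bdry_fixes act x0 h (\<lambda>n. act (v [^] n) x0)"
      using loxodromic_bdry_fixes[OF lv, of h] v gh by auto
    then have "bdry_fixes act x0 h (\<lambda>n. act (u [^] n) x0)"
      using bdry_fixes_equiv[OF gh(2) eq] by simp
    ultimately show False using ind loxodromic_conv_infty[OF lu] by blast
  qed
qed

text \<open>WPD yields a finite stabilizer for some power without control of its displacement. A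
  higher power keeps finiteness, as an element nearly fixing both ends of the longer segment nearly
  fixes the intermediate orbit point too.\<close>

lemma finite_Stab_pow:
  assumes h: "WPD G act x0 h"
  shows "\<exists>M. finite (Stab G act K x0 (act (h [^] (M::nat)) x0)) \<and> D \<le> len (h [^] M)"
proof -
  have lox: "loxodromic G act x0 h" using h by (simp add: WPD_def)
  obtain C where C: "\<And>i j k :: nat. i \<le> j \<Longrightarrow> j \<le> k \<Longrightarrow>
           gromov_prod (act (h [^] j) x0) (act (h [^] i) x0) (act (h [^] k) x0) \<le> C"
    using loxodromic_quasi_geodesic[OF lox] by blast
  \<comment> \<open>Covers the bounds at \<open>x0\<close> and at the intermediate point; the 1
    secures positivity, since \<open>K\<close> is arbitrary here.\<close>
  define K' where "K' = max 1 (max K (K + 2 * C + 2 * \<delta>))"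
  have "0 < K'" by (simp add: K'_def)
  then obtain M1 :: nat where M1: "finite (Stab G act K' x0 (act (h [^] M1) x0))"
    using h unfolding WPD_def by blast
  obtain N :: nat where N: "\<forall>n\<ge>N. D \<le> len (h [^] n)" using loxodromic_len_unbounded[OF lox] by blast
  define M where "M = max M1 N"
  have "Stab G act K x0 (act (h [^] M) x0) \<subseteq> Stab G act K' x0 (act (h [^] M1) x0)"
  proof
    fix s assume "s \<in> Stab G act K x0 (act (h [^] M) x0)"
    then have s: "s \<in> carrier G" "dist x0 (act s x0) \<le> K"
        "dist (act (h [^] M) x0) (act s (act (h [^] M) x0)) \<le> K" by (auto simp: Stab_def)
    let ?p = "act (h [^] M1) x0"
    have "gromov_prod ?p x0 (act (h [^] M) x0) \<le> C" using C[of 0 M1 M] by (simp add: M_def)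
    moreover have "dist x0 (act s ?p) \<le> dist x0 ?p + K"
      using s dist_triangle[of x0 "act s ?p" "act s x0"] by simp
    moreover have "dist (act (h [^] M) x0) (act s ?p) \<le> dist (act (h [^] M) x0) ?p + K"
      using s dist_triangle[of "act (h [^] M) x0" "act s ?p" "act s (act (h [^] M) x0)"] by simp
    ultimately have "dist ?p (act s ?p) \<le> K + 2 * C + 2 * \<delta>" by (rule near_geodesic_close)
    moreover have "K \<le> K'" "K + 2 * C + 2 * \<delta> \<le> K'" by (simp_all add: K'_def)
    ultimately show "s \<in> Stab G act K' x0 ?p" using s by (auto simp: Stab_def)
  qed
  then have "finite (Stab G act K x0 (act (h [^] M) x0))" using M1 finite_subset by blast
  moreover have "D \<le> len (h [^] M)" using N by (simp add: M_def)
  ultimately show ?thesis by blast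
qed

end

section \<open>A criterion for WPD\<close>

lemma floor_eq_abs_diff: "\<lfloor>x::real\<rfloor> = \<lfloor>y\<rfloor> \<Longrightarrow> \<bar>x - y\<bar> \<le> 1"
proof -
  assume eq: "\<lfloor>x\<rfloor> = \<lfloor>y\<rfloor>"
  define k where "k = \<lfloor>y\<rfloor>"
  have "real_of_int k \<le> x \<and> x < real_of_int k + 1" "real_of_int k \<le> y \<and> y < real_of_int k + 1"
    using eq floor_eq_iff[of x k] floor_eq_iff[of y k] by (simp_all add: k_def)
  then show ?thesis by (simp add: abs_le_iff)
qed

context hyp_action
begin

section \<open>Conjugation and coarse stabilizers of long segments\<close>

lemma Stab_translate:
  assumes c: "c \<in> carrier G"
  shows "Stab G act K (act c y) (act c z) \<subseteq> (\<lambda>s. c \<otimes> s \<otimes> inv c) ` Stab G act K y z"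
proof
  fix s assume "s \<in> Stab G act K (act c y) (act c z)"
  then have s: "s \<in> carrier G" "dist (act c y) (act s (act c y)) \<le> K"
      "dist (act c z) (act s (act c z)) \<le> K" by (auto simp: Stab_def)
  have "dist y (act (inv c \<otimes> s \<otimes> c) y) = dist (act c y) (act s (act c y))" for y
    using c s(1) by (simp add: act_mult dist_act_inv)
  then have "inv c \<otimes> s \<otimes> c \<in> Stab G act K y z" using s c by (simp add: Stab_def)
  moreover have "s = c \<otimes> (inv c \<otimes> s \<otimes> c) \<otimes> inv c"
    using s(1) c by (simp add: m_assoc) (simp add: m_assoc[symmetric])
  ultimately show "s \<in> (\<lambda>s. c \<otimes> s \<otimes> inv c) ` Stab G act K y z" by blast
qed

lemma finite_Stab_translate:
  "finite (Stab G act K y z) \<Longrightarrow> c \<in> carrier G \<Longrightarrow> finite (Stab G act K (act c y) (act c z))"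
  using Stab_translate by (meson finite_imageI finite_subset)

lemma pow_conjugate:
  assumes "h \<in> carrier G" "c \<in> carrier G"
  shows "(c \<otimes> h \<otimes> inv c) [^] (n::nat) = c \<otimes> h [^] n \<otimes> inv c"
proof (induction n)
  case (Suc n)
  have "inv c \<otimes> (c \<otimes> (h \<otimes> inv c)) = h \<otimes> inv c"
    using assms by (simp add: m_assoc[symmetric])
  then show ?case using Suc assms by (simp add: m_assoc)
qed (use assms in simp)

text \<open>Displacements change by at most \<open>2 * len c\<close>, which disappears after
  division by \<open>n\<close>; finiteness at \<open>y\<close> is finiteness for \<open>h\<close> at
  \<open>act (inv c) y\<close>.\<close>

lemma WPD_conjugate:
  assumes h: "WPD G act x0 h" and c: "c \<in> carrier G"
  shows "WPD G act x0 (c \<otimes> h \<otimes> inv c)"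
  unfolding WPD_def
proof (intro conjI allI impI)
  have hG: "h \<in> carrier G" using h by (simp add: WPD_def loxodromic_def)
  obtain l where l: "l > 0" "(\<lambda>n. len (h [^] n) / real n) \<longlonglongrightarrow> l"
    using h by (auto simp: WPD_def loxodromic_def len_def)
  have bound: "\<bar>len (c \<otimes> h [^] n \<otimes> inv c) - len (h [^] n)\<bar> \<le> 2 * len c" for n :: nat
  proof -
    have "h [^] n = inv c \<otimes> (c \<otimes> h [^] n \<otimes> inv c) \<otimes> c"
      using hG c by (simp add: m_assoc) (simp add: m_assoc[symmetric])
    then have "len (h [^] n) \<le> len c + len (c \<otimes> h [^] n \<otimes> inv c) + len c"
      using len_mult[of "inv c \<otimes> (c \<otimes> h [^] n \<otimes> inv c)" c]
        len_mult[of "inv c" "c \<otimes> h [^] n \<otimes> inv c"] hG c by simp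
    moreover have "len (c \<otimes> h [^] n \<otimes> inv c) \<le> len c + len (h [^] n) + len c"
      using len_mult[of "c \<otimes> h [^] n" "inv c"] len_mult[of c "h [^] n"] hG c by simp
    ultimately show ?thesis by linarith
  qed
  have "(\<lambda>n. (len (c \<otimes> h [^] n \<otimes> inv c) - len (h [^] n)) / real n) \<longlonglongrightarrow> 0"
  proof (rule Lim_null_comparison)
    show "\<forall>\<^sub>F n in sequentially.
        norm ((len (c \<otimes> h [^] n \<otimes> inv c) - len (h [^] n)) / real n) \<le> 2 * len c * (1 / real n)"
      using bound by (intro always_eventually) (auto simp: abs_divide divide_right_mono)
    have "(\<lambda>n. 1 / real n) \<longlonglongrightarrow> 0" by real_asymp
    from tendsto_mult_right_zero[OF this] show "(\<lambda>n. 2 * len c * (1 / real n)) \<longlonglongrightarrow> 0" .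
  qed
  from tendsto_add[OF this l(2)]
  have "(\<lambda>n. len (c \<otimes> h [^] n \<otimes> inv c) / real n) \<longlonglongrightarrow> l"
    by (simp add: diff_divide_distrib)
  then show "loxodromic G act x0 (c \<otimes> h \<otimes> inv c)"
    using l(1) hG c by (auto simp: loxodromic_def len_def pow_conjugate)
  fix K :: real and y assume "0 < K"
  then obtain M :: nat where
    "finite (Stab G act K (act (inv c) y) (act (h [^] M) (act (inv c) y)))"
    using h unfolding WPD_def by blast
  from finite_Stab_translate[OF this c]
  show "\<exists>M::nat. finite (Stab G act K y (act ((c \<otimes> h \<otimes> inv c) [^] M) y))"
    using hG c by (auto simp: pow_conjugate act_mult)
qed

text \<open>Seen from \<open>act s X\<close>, the points \<open>a\<close> and \<open>act s a\<close>
  have a large product because \<open>X\<close> is far from \<open>a\<close> compared with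
  \<open>K\<close>; likewise for \<open>e\<close>. Exchanging both ends costs
  \<open>2 * \<delta>\<close>, and \<open>K\<close> drops out of the conclusion.\<close>

lemma gromov_prod_moved_point:
  assumes s: "s \<in> carrier G" "dist a (act s a) \<le> K" "dist e (act s e) \<le> K"
    and X: "gromov_prod X a e \<le> C" "K + C + 2 * \<delta> < dist X a" "K + C + 2 * \<delta> < dist X e"
  shows "gromov_prod (act s X) a e \<le> C + 2 * \<delta>"
proof -
  have far: "C + 2 * \<delta> < gromov_prod (act s X) b (act s b)"
    if "dist b (act s b) \<le> K" "K + C + 2 * \<delta> < dist X b" for b
    using gromov_prod_move_left[of "act s X" "act s b" "act s b" b] that s(1)
    by (simp add: gromov_prod_same dist_commute)
  have "gromov_prod (act s X) (act s a) (act s e) \<le> C" using s X by simp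
  then have "gromov_prod (act s X) a (act s e) \<le> C + \<delta>"
    using far[of a] s X \<delta>_nonneg
    by (intro hyp_le_right[where y = "act s a"]) (auto simp: gromov_prod_commute)
  then have "gromov_prod (act s X) a e \<le> C + \<delta> + \<delta>"
    by (rule hyp_le_left) (use far[of e] s X in simp)
  then show ?thesis by simp
qed

lemma same_position_close:
  assumes "gromov_prod p a e \<le> C" "gromov_prod p' a e \<le> C" "\<bar>dist a p - dist a p'\<bar> \<le> 1"
  shows "dist p (p'::'x) \<le> 4 * C + 2 * \<delta> + 1"
proof -
  have "0 \<le> C" using assms(1) gromov_prod_nonneg[of p a e] by linarith
  have "dist p p' \<le> (1 + 2 * C) + 2 * C + 2 * \<delta>"
  proof (rule near_geodesic_close[OF assms(1)])
    show "dist a p' \<le> dist a p + (1 + 2 * C)" using assms(3) \<open>0 \<le> C\<close> by linarith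
    show "dist e p' \<le> dist e p + (1 + 2 * C)"
      using assms gromov_prod_nonneg[of p a e] by (simp add: gromov_prod_def dist_commute)
  qed
  then show ?thesis by simp
qed

text \<open>Elements moving both ends of a long segment by a bounded amount act on its middle as
  translations of bounded length; after sorting them by these translation lengths, quotients of two
  elements in the same class move the middle by an amount independent of the original bound.\<close>

lemma finite_Stab_if_middle:
  assumes gp: "gromov_prod P a e \<le> C" "gromov_prod Q a e \<le> C"
    and far: "K + C + 2 * \<delta> < dist P a" "K + C + 2 * \<delta> < dist P e"
             "K + C + 2 * \<delta> < dist Q a" "K + C + 2 * \<delta> < dist Q e"
    and fin: "finite (Stab G act (4 * C + 10 * \<delta> + 1) P Q)"
  shows "finite (Stab G act K a e)"
proof (rule ccontr)
  let ?S = "Stab G act K a e"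
  \<comment> \<open>The class of \<open>s\<close> records, up to 1, how far from \<open>a\<close>
    the images of \<open>P\<close> and \<open>Q\<close> lie. Only finitely many classes occur, and
    equal classes force the images to be close.\<close>
  define \<phi> where "\<phi> = (\<lambda>s. (\<lfloor>dist a (act s P)\<rfloor>, \<lfloor>dist a (act s Q)\<rfloor>))"
  assume inf: "infinite ?S"
  have le: "0 \<le> \<lfloor>dist a (act s X)\<rfloor> \<and> \<lfloor>dist a (act s X)\<rfloor> \<le> \<lfloor>dist a X + K\<rfloor>" if "s \<in> ?S" for s X
  proof -
    have "dist a (act s X) \<le> dist a X + K"
      using that dist_triangle[of a "act s X" "act s a"] by (auto simp: Stab_def)
    then show ?thesis by (simp add: floor_mono)
  qed
  have "\<phi> ` ?S \<subseteq> {0..\<lfloor>dist a P + K\<rfloor>} \<times> {0..\<lfloor>dist a Q + K\<rfloor>}"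
    using le by (auto simp: \<phi>_def)
  then have "finite (\<phi> ` ?S)" by (rule finite_subset) simp
  then obtain t where t: "infinite (\<phi> -` {t} \<inter> ?S)"
    using inf_img_fin_dom'[OF _ inf] by blast
  then obtain s1 where s1: "s1 \<in> \<phi> -` {t} \<inter> ?S" using infinite_imp_nonempty by blast
  then have s1G: "s1 \<in> carrier G" by (simp add: Stab_def)
  have "\<phi> -` {t} \<inter> ?S \<subseteq> (\<lambda>g. s1 \<otimes> g) ` Stab G act (4 * C + 10 * \<delta> + 1) P Q"
  proof
    fix s assume s: "s \<in> \<phi> -` {t} \<inter> ?S"
    then have sG: "s \<in> carrier G" by (simp add: Stab_def)
    have close: "dist X (act (inv s1 \<otimes> s) X) \<le> 4 * C + 10 * \<delta> + 1"
      if X: "gromov_prod X a e \<le> C" "K + C + 2 * \<delta> < dist X a" "K + C + 2 * \<delta> < dist X e"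
        and fl: "\<lfloor>dist a (act s1 X)\<rfloor> = \<lfloor>dist a (act s X)\<rfloor>" for X
    proof -
      have "gromov_prod (act u X) a e \<le> C + 2 * \<delta>" if "u \<in> ?S" for u
        using that X by (intro gromov_prod_moved_point) (auto simp: Stab_def)
      then have "gromov_prod (act s1 X) a e \<le> C + 2 * \<delta>" "gromov_prod (act s X) a e \<le> C + 2 * \<delta>"
        using s s1 by auto
      moreover have "\<bar>dist a (act s1 X) - dist a (act s X)\<bar> \<le> 1"
        using fl by (rule floor_eq_abs_diff)
      ultimately have "dist (act s1 X) (act s X) \<le> 4 * (C + 2 * \<delta>) + 2 * \<delta> + 1"
        by (rule same_position_close)
      then show ?thesis using s1G sG by (simp add: act_mult dist_act_inv)
    qed
    have "inv s1 \<otimes> s \<in> Stab G act (4 * C + 10 * \<delta> + 1) P Q"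
      using close[of P] close[of Q] gp far s s1 s1G sG by (auto simp: Stab_def \<phi>_def)
    moreover have "s = s1 \<otimes> (inv s1 \<otimes> s)" using s1G sG by (simp add: m_assoc[symmetric])
    ultimately show "s \<in> (\<lambda>g. s1 \<otimes> g) ` Stab G act (4 * C + 10 * \<delta> + 1) P Q" by blast
  qed
  then show False using t fin by (meson finite_imageI finite_subset)
qed

text \<open>For \<open>h = f \<otimes> v\<close> the path through \<open>x0\<close>,
  \<open>f x0\<close>, \<open>h x0\<close>, \<open>h f x0\<close> and so on alternates translates of
  \<open>[x0, f x0]\<close> and \<open>[x0, v x0]\<close>; \<open>gp1\<close> and \<open>gp2\<close>
  bound its two kinds of corner. A translate of the first edge deep inside a long stretch feeds
  \<open>finite_Stab_if_middle\<close>.\<close>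

lemma WPD_criterion:
  assumes f: "f \<in> carrier G" and v: "v \<in> carrier G" and "0 \<le> R"
    and gp1: "gromov_prod x0 (act (inv f) x0) (act v x0) \<le> R"
    and gp2: "gromov_prod x0 (act (inv v) x0) (act f x0) \<le> R"
    and lf: "2 * R + 10 * \<delta> + 1 \<le> len f" and lv: "2 * R + 10 * \<delta> + 1 \<le> len v"
    and fin: "finite (Stab G act (4 * R + 18 * \<delta> + 1) x0 (act f x0))"
  shows "WPD G act x0 (f \<otimes> v)"
proof -
  define h where "h = f \<otimes> v"
  define C where "C = R + 2 * \<delta>"
  define p where "p = (\<lambda>n::nat. act (h [^] (n div 2)) (if even n then x0 else act f x0))"
  have h: "h \<in> carrier G" using f v by (simp add: h_def)
  have hp: "act (h [^] Suc q) y = act (h [^] q) (act f (act v y))" for q :: nat and y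
    using f v h act_pow_add[OF h, of q 1] by (simp add: h_def act_mult)
  have p_even: "p (2 * q) = act (h [^] q) x0" and p_odd: "p (Suc (2 * q)) = act (h [^] q) (act f x0)" for q :: nat
    by (simp_all add: p_def)
  have p_even2: "p (Suc (Suc (2 * q))) = act (h [^] q) (act f (act v x0))"
    and p_odd3: "p (Suc (Suc (Suc (2 * q)))) = act (h [^] q) (act f (act v (act f x0)))" for q :: nat
    using p_even[of "Suc q"] p_odd[of "Suc q"] hp by (simp_all del: nat_pow_Suc)
  have parity: "\<exists>q. i = 2 * q \<or> i = Suc (2 * q)" for i :: nat by presburger
  have R: "gromov_prod (p (Suc i)) (p i) (p (Suc (Suc i))) \<le> R" for i
  proof -
    obtain q where "i = 2 * q \<or> i = Suc (2 * q)" using parity by blast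
    then show ?thesis
    proof
      assume i: "i = 2 * q"
      have "gromov_prod (act f x0) x0 (act f (act v x0)) \<le> R"
        using gp1 f by (simp add: gromov_prod_act_inv)
      then show ?thesis using h by (simp add: i p_even p_odd p_even2)
    next
      assume i: "i = Suc (2 * q)"
      have "gromov_prod (act v x0) x0 (act v (act f x0)) \<le> R"
        using gp2 v by (simp add: gromov_prod_act_inv)
      then show ?thesis using h f by (simp add: i p_odd p_even2 p_odd3)
    qed
  qed
  have d: "2 * R + 10 * \<delta> + 1 \<le> dist (p i) (p (Suc i))" for i
  proof -
    obtain q where "i = 2 * q \<or> i = Suc (2 * q)" using parity by blast
    then show ?thesis using h f lf lv by (auto simp: p_even p_odd p_even2 len_def)
  qed
  note chain_g = chain_gromov_prod[of p R, OF R d \<open>0 \<le> R\<close>, folded C_def]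
  have chain_d: "real (k - j) \<le> dist (p j) (p k)" if "j \<le> k" for j k
    using chain_dist[of p R "k - j" j, OF R d \<open>0 \<le> R\<close>] that by simp
  have lower: "real n \<le> len (h [^] n)" for n :: nat
    using chain_d[of 0 "2 * n"] p_even[of 0] by (simp add: p_even len_def)
  have "loxodromic G act x0 h"
  proof -
    obtain l where l: "(\<lambda>n. len (h [^] n) / real n) \<longlonglongrightarrow> l"
      using subadditive_convergent[of "\<lambda>n. len (h [^] n)"] h
      by (force simp: nat_pow_mult[symmetric] len_mult)
    have "1 \<le> l"
    proof (rule LIMSEQ_le_const[OF l])
      show "\<exists>N. \<forall>n\<ge>N. 1 \<le> len (h [^] n) / real n"
        using lower by (intro exI[of _ 1]) (auto simp: divide_simps)
    qed
    then show ?thesis using l h by (auto simp: loxodromic_def len_def intro!: exI[of _ l])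
  qed
  moreover have "\<exists>M::nat. finite (Stab G act K y (act (h [^] M) y))" for K y
  proof -
    \<comment> \<open>Moves the endpoints from the orbit of \<open>y\<close> to the orbit of
      \<open>x0\<close>.\<close>
    define K2 where "K2 = K + 2 * dist x0 y"
    obtain i :: nat where i: "K2 + C + 2 * \<delta> < real i" using reals_Archimedean2 by blast
    \<comment> \<open>The stretch from \<open>x0\<close> to \<open>e\<close> has
      \<open>4 * i + 2\<close> edges; its middle part contains the translate of
      \<open>[x0, f x0]\<close> that starts at \<open>p (2 * i)\<close>, at distance at least
      \<open>2 * i\<close> from both ends.\<close>
    define M where "M = Suc (2 * i)"
    define e where "e = p (2 * M)"
    have p0: "p 0 = x0" using p_even[of 0] by simp
    have far: "K2 + C + 2 * \<delta> < dist (p j) x0" "K2 + C + 2 * \<delta> < dist (p j) e"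
      if "j = 2 * i \<or> j = Suc (2 * i)" for j
      using chain_d[of 0 j] chain_d[of j "2 * M"] that i
      by (auto simp: p0 e_def M_def dist_commute)
    have gp: "gromov_prod (p j) x0 e \<le> C" if "j = 2 * i \<or> j = Suc (2 * i)" for j
      using chain_g[of 0 j "2 * M"] that by (auto simp: p0 e_def M_def)
    have "4 * C + 10 * \<delta> + 1 = 4 * R + 18 * \<delta> + 1" by (simp add: C_def)
    then have "finite (Stab G act (4 * C + 10 * \<delta> + 1) (p (2 * i)) (p (Suc (2 * i))))"
      unfolding p_even p_odd using fin h by (metis finite_Stab_translate nat_pow_closed)
    then have "finite (Stab G act K2 x0 e)"
      using far gp by (intro finite_Stab_if_middle[of "p (2 * i)" x0 e C "p (Suc (2 * i))"]) auto
    moreover have "Stab G act K y (act (h [^] M) y) \<subseteq> Stab G act K2 x0 e"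
    proof
      fix s assume "s \<in> Stab G act K y (act (h [^] M) y)"
      then have s: "s \<in> carrier G" "dist y (act s y) \<le> K"
        "dist (act (h [^] M) y) (act s (act (h [^] M) y)) \<le> K" by (auto simp: Stab_def)
      have "dist z (act s z) \<le> 2 * dist z w + dist w (act s w)" for z w
        using dist_triangle[of z "act s z" w] dist_triangle[of w "act s z" "act s w"] s(1)
        by (simp add: dist_commute)
      from this[of x0 y] this[of e "act (h [^] M) y"] s h
      show "s \<in> Stab G act K2 x0 e"
        by (simp add: Stab_def K2_def e_def p_even)
    qed
    ultimately show ?thesis by (meson finite_subset)
  qed
  ultimately show ?thesis unfolding WPD_def h_def by blast
qed

end

section \<open>The spreading of random walks\<close>

lemma expectation_bind_pmf:
  fixes g :: "'b \<Rightarrow> real"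
  assumes bound: "\<And>x y. x \<in> set_pmf p \<Longrightarrow> y \<in> set_pmf (f x) \<Longrightarrow> \<bar>g y\<bar> \<le> B"
  shows "measure_pmf.expectation (bind_pmf p f) g
       = measure_pmf.expectation p (\<lambda>x. measure_pmf.expectation (f x) g)"
proof -
  \<comment> \<open>Truncation makes the integrand globally bounded, as \<open>integral_bind\<close>
    requires, and changes nothing on the support.\<close>
  define h where "h = (\<lambda>y. max (- \<bar>B\<bar>) (min \<bar>B\<bar> (g y)))"
  have hg: "h y = g y" if "x \<in> set_pmf p" "y \<in> set_pmf (f x)" for x y
    using bound[OF that] by (auto simp: h_def)
  have "measure_pmf.expectation (bind_pmf p f) g = measure_pmf.expectation (bind_pmf p f) h"
    by (intro integral_cong_AE) (auto simp: AE_measure_pmf_iff hg)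
  also have "\<dots> = (\<integral>x. (\<integral>y. h y \<partial>measure_pmf (f x)) \<partial>measure_pmf p)"
    unfolding measure_pmf_bind
    by (rule integral_bind[where K = "count_space UNIV" and B = "\<bar>B\<bar>" and B' = 1])
       (auto simp: h_def measure_pmf.emeasure_space_le_1 measure_pmf_in_subprob_algebra)
  also have "\<dots> = (\<integral>x. (\<integral>y. g y \<partial>measure_pmf (f x)) \<partial>measure_pmf p)"
    by (intro integral_cong_AE) (auto simp: AE_measure_pmf_iff hg intro!: integral_cong_AE)
  finally show ?thesis .
qed

lemma integrable_pmf_bounded:
  fixes g :: "'b \<Rightarrow> real"
  assumes "\<And>x. x \<in> set_pmf p \<Longrightarrow> \<bar>g x\<bar> \<le> B"
  shows "integrable (measure_pmf p) g"
  using assms by (intro measure_pmf.integrable_const_bound[where B = B]) (auto simp: AE_measure_pmf_iff)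

lemma expectation_mono_pmf:
  fixes g h :: "'b \<Rightarrow> real"
  assumes "\<And>x. x \<in> set_pmf p \<Longrightarrow> \<bar>g x\<bar> \<le> B" "\<And>x. x \<in> set_pmf p \<Longrightarrow> \<bar>h x\<bar> \<le> B'"
    and "\<And>x. x \<in> set_pmf p \<Longrightarrow> g x \<le> h x"
  shows "measure_pmf.expectation p g \<le> measure_pmf.expectation p h"
  using assms by (intro integral_mono_AE integrable_pmf_bounded) (auto simp: AE_measure_pmf_iff)

lemma expectation_le_const_pmf:
  fixes g :: "'b \<Rightarrow> real"
  assumes "\<And>x. x \<in> set_pmf p \<Longrightarrow> \<bar>g x\<bar> \<le> B" "\<And>x. x \<in> set_pmf p \<Longrightarrow> g x \<le> c"
  shows "measure_pmf.expectation p g \<le> c"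
  using expectation_mono_pmf[of p g B "\<lambda>_. c" "\<bar>c\<bar>"] assms by simp

lemma expectation_ge_const_pmf:
  fixes g :: "'b \<Rightarrow> real"
  assumes "\<And>x. x \<in> set_pmf p \<Longrightarrow> \<bar>g x\<bar> \<le> B" "\<And>x. x \<in> set_pmf p \<Longrightarrow> c \<le> g x"
  shows "c \<le> measure_pmf.expectation p g"
  using expectation_mono_pmf[of p "\<lambda>_. c" "\<bar>c\<bar>" g B] assms by simp

lemma prob_mono_pmf:
  assumes "\<And>x. x \<in> set_pmf p \<Longrightarrow> x \<in> A \<Longrightarrow> x \<in> B"
  shows "measure_pmf.prob p A \<le> measure_pmf.prob p B"
  using assms by (intro measure_pmf.finite_measure_mono_AE) (auto simp: AE_measure_pmf_iff)

lemma prob_bind_pmf: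
  "measure_pmf.prob (bind_pmf p f) A = measure_pmf.expectation p (\<lambda>x. measure_pmf.prob (f x) A)"
  using expectation_bind_pmf[of p f "indicator A :: _ \<Rightarrow> real" 1] by (simp add: indicator_def)

text \<open>Maximum principle: iterating this bound drives \<open>M\<close> down to \<open>1 / card T\<close>.\<close>

lemma expectation_le_spread:
  fixes q :: "'b \<Rightarrow> real"
  assumes q: "\<And>x. 0 \<le> q x" "\<And>x. x \<in> set_pmf \<nu> \<Longrightarrow> q x \<le> M"
    and T: "finite T" "\<And>x. x \<in> T \<Longrightarrow> \<theta> \<le> pmf \<nu> x" "0 < \<theta>" and sum: "sum q T \<le> 1"
  shows "measure_pmf.expectation \<nu> q \<le> (1 - real (card T) * \<theta>) * M + \<theta>"
proof -
  have TS: "T \<subseteq> set_pmf \<nu>" using T by (force simp: set_pmf_iff)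
  have bdd: "\<bar>q x\<bar> \<le> \<bar>M\<bar>" "\<bar>M - q x\<bar> \<le> 2 * \<bar>M\<bar>" if "x \<in> set_pmf \<nu>" for x
    using q(1)[of x] q(2)[OF that] by auto
  have "\<theta> * (real (card T) * M - 1) \<le> \<theta> * (real (card T) * M - sum q T)"
    using sum T(3) by (intro mult_left_mono) auto
  also have "\<dots> = (\<Sum>x\<in>T. \<theta> * (M - q x))"
    by (simp add: sum_subtractf sum_distrib_left right_diff_distrib)
  also have "\<dots> \<le> (\<Sum>x\<in>T. pmf \<nu> x * (M - q x))"
    using T TS q(2) by (intro sum_mono mult_right_mono) auto
  also have "\<dots> = measure_pmf.expectation \<nu> (\<lambda>x. (M - q x) * indicator T x)"
    by (subst integral_measure_pmf[OF T(1)]) (auto intro!: sum.cong simp: indicator_def split: if_splits)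
  also have "\<dots> \<le> measure_pmf.expectation \<nu> (\<lambda>x. M - q x)"
    using bdd q(2) by (intro expectation_mono_pmf[where B = "2 * \<bar>M\<bar>" and B' = "2 * \<bar>M\<bar>"])
      (auto simp: indicator_def)
  also have "\<dots> = M - measure_pmf.expectation \<nu> q"
    using bdd(1) by (subst Bochner_Integration.integral_diff) (auto intro!: integrable_pmf_bounded)
  finally show ?thesis by (simp add: algebra_simps)
qed

section \<open>The random walk: splitting, reversal, conditioning\<close>

locale hyp_walk = hyp_action +
  fixes \<mu> :: "'a pmf" and L :: real
  assumes supp: "set_pmf \<mu> \<subseteq> carrier G"
    and len_supp: "g \<in> set_pmf \<mu> \<Longrightarrow> len g \<le> L"
begin

abbreviation W :: "nat \<Rightarrow> 'a pmf" where "W n \<equiv> walk_dist G \<mu> n"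

lemma L_nonneg: "0 \<le> L"
  using len_supp set_pmf_not_empty[of \<mu>] by (meson ex_in_conv len_nonneg order_trans)

lemma walk_carrier: "w \<in> set_pmf (W n) \<Longrightarrow> w \<in> carrier G"
  by (induction n arbitrary: w) (use supp in auto)

lemma walk_len: "w \<in> set_pmf (W n) \<Longrightarrow> len w \<le> L * real n"
proof (induction n arbitrary: w)
  case (Suc n)
  then obtain v g where v: "v \<in> set_pmf (W n)" and g: "g \<in> set_pmf \<mu>" and w: "w = v \<otimes> g" by auto
  then have "len w \<le> len v + len g" using walk_carrier supp by (auto intro: len_mult)
  also have "\<dots> \<le> L * real n + L" using Suc.IH[OF v] len_supp[OF g] by simp
  finally show ?case by (simp add: algebra_simps)
qed simp

lemma walk_add: "W (m + n) = bind_pmf (W m) (\<lambda>x. map_pmf (\<lambda>y. x \<otimes> y) (W n))"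
proof (induction n)
  case 0
  have "bind_pmf (W m) (\<lambda>x. return_pmf (x \<otimes> \<one>)) = bind_pmf (W m) return_pmf"
    by (intro bind_pmf_cong) (auto simp: walk_carrier)
  then show ?case by (simp add: bind_return_pmf')
next
  case (Suc n)
  have "W (m + Suc n) = bind_pmf (W m) (\<lambda>x. bind_pmf (W n) (\<lambda>y. map_pmf (\<lambda>g. x \<otimes> y \<otimes> g) \<mu>))"
    by (simp add: Suc bind_assoc_pmf bind_map_pmf)
  also have "\<dots> = bind_pmf (W m) (\<lambda>x. bind_pmf (W n) (\<lambda>y. map_pmf (\<lambda>g. x \<otimes> (y \<otimes> g)) \<mu>))"
    using supp by (intro bind_pmf_cong map_pmf_cong refl) (auto simp: walk_carrier m_assoc)
  also have "\<dots> = bind_pmf (W m) (\<lambda>x. map_pmf (\<lambda>y. x \<otimes> y) (W (Suc n)))"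
    by (simp add: map_bind_pmf map_pmf_comp)
  finally show ?case .
qed

lemma walk_one: "W 1 = \<mu>"
proof -
  have "map_pmf (\<lambda>g. \<one> \<otimes> g) \<mu> = map_pmf id \<mu>"
    using supp by (intro map_pmf_cong) auto
  then show ?thesis by (simp add: bind_return_pmf)
qed

lemma walk_mult_mem:
  "x \<in> set_pmf (W m) \<Longrightarrow> y \<in> set_pmf (W n) \<Longrightarrow> x \<otimes> y \<in> set_pmf (W (m + n))"
  by (auto simp: walk_add)

lemma walk_pow_mem: "x \<in> set_pmf (W m) \<Longrightarrow> x [^] (k::nat) \<in> set_pmf (W (m * k))"
proof (induction k)
  case (Suc k)
  then show ?case using walk_mult_mem[of "x [^] k" "m * k" x m] by (simp add: add.commute)
qed simp

lemma gen_semigroup_walk: "x \<in> gen_semigroup G (set_pmf \<mu>) \<Longrightarrow> \<exists>n. x \<in> set_pmf (W n) \<and> 0 < n"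
proof (induction rule: gen_semigroup.induct)
  case (base s)
  then show ?case using walk_one by (intro exI[of _ 1]) simp
next
  case (mult a b)
  then show ?case using walk_mult_mem by (metis add_gr_0)
qed

lemma expectation_walk_add:
  fixes f :: "'a \<Rightarrow> real"
  assumes "\<And>x y. x \<in> set_pmf (W m) \<Longrightarrow> y \<in> set_pmf (W n) \<Longrightarrow> \<bar>f (x \<otimes> y)\<bar> \<le> B"
  shows "measure_pmf.expectation (W (m + n)) f
       = measure_pmf.expectation (W m) (\<lambda>x. measure_pmf.expectation (W n) (\<lambda>y. f (x \<otimes> y)))"
  unfolding walk_add using assms by (subst expectation_bind_pmf[where B = B]) auto

lemma prob_walk_add:
  "measure_pmf.prob (W (m + n)) A
     = measure_pmf.expectation (W m) (\<lambda>x. measure_pmf.prob (W n) {y. x \<otimes> y \<in> A})"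
  unfolding walk_add by (simp add: prob_bind_pmf vimage_def)

text \<open>Inversion reverses the order of the letters, which does not affect the law at a fixed
  time because they are i.i.d. The induction therefore has to peel off the first letter instead of
  the last.\<close>

lemma walk_inv: "walk_dist G (map_pmf (\<lambda>g. inv g) \<mu>) n = map_pmf (\<lambda>g. inv g) (W n)"
proof (induction n)
  case (Suc n)
  have "walk_dist G (map_pmf (\<lambda>g. inv g) \<mu>) (Suc n)
      = bind_pmf (W n) (\<lambda>w. bind_pmf \<mu> (\<lambda>g. return_pmf (inv w \<otimes> inv g)))"
    by (simp add: Suc bind_map_pmf map_pmf_comp) (simp add: map_pmf_def)
  also have "\<dots> = bind_pmf (W n) (\<lambda>w. bind_pmf \<mu> (\<lambda>g. return_pmf (inv (g \<otimes> w))))"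
    using supp by (intro bind_pmf_cong refl) (auto simp: inv_mult_group walk_carrier subset_iff)
  also have "\<dots> = bind_pmf \<mu> (\<lambda>g. bind_pmf (W n) (\<lambda>w. return_pmf (inv (g \<otimes> w))))"
    by (rule bind_commute_pmf)
  also have "\<dots> = map_pmf (\<lambda>g. inv g) (W (1 + n))"
    unfolding walk_add walk_one by (simp add: map_bind_pmf map_pmf_comp) (simp add: map_pmf_def)
  finally show ?case by simp
qed simp

text \<open>Condition on the first \<open>j\<close> letters \<open>g\<close>: the rest must fall
  into a set attached to \<open>act (inv g) z\<close>. For \<open>g\<close> in \<open>T\<close>
  these sets are disjoint, so their probabilities sum to at most 1. \<open>A'\<close> may be larger
  than \<open>A\<close>, which absorbs the change of basepoint for shadows.\<close>

lemma prob_walk_spread: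
  assumes M: "\<And>z. measure_pmf.prob (W k) (A' z) \<le> M"
    and sub: "\<And>g w z. g \<in> set_pmf (W j) \<Longrightarrow> w \<in> carrier G \<Longrightarrow> g \<otimes> w \<in> A z \<Longrightarrow> w \<in> A' (act (inv g) z)"
    and T: "finite T" "\<And>g. g \<in> T \<Longrightarrow> \<theta> \<le> pmf (W j) g" "0 < \<theta>"
    and disj: "\<And>g g'. g \<in> T \<Longrightarrow> g' \<in> T \<Longrightarrow> g \<noteq> g' \<Longrightarrow> A' (act (inv g) z) \<inter> A' (act (inv g') z) = {}"
  shows "measure_pmf.prob (W (j + k)) (A z) \<le> (1 - real (card T) * \<theta>) * M + \<theta>"
proof -
  have TS: "T \<subseteq> set_pmf (W j)" using T by (force simp: set_pmf_iff)
  have "measure_pmf.prob (W (j + k)) (A z)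
      = measure_pmf.expectation (W j) (\<lambda>g. measure_pmf.prob (W k) {w. g \<otimes> w \<in> A z})"
    by (rule prob_walk_add)
  also have "\<dots> \<le> measure_pmf.expectation (W j) (\<lambda>g. measure_pmf.prob (W k) (A' (act (inv g) z)))"
    by (intro expectation_mono_pmf[where B = 1 and B' = 1] prob_mono_pmf)
       (auto intro: sub walk_carrier)
  also have "\<dots> \<le> (1 - real (card T) * \<theta>) * M + \<theta>"
  proof (rule expectation_le_spread[OF _ _ T])
    have "(\<Sum>g\<in>T. measure_pmf.prob (W k) (A' (act (inv g) z)))
       = measure_pmf.prob (W k) (\<Union>g\<in>T. A' (act (inv g) z))"
      using T(1) disj by (intro measure_pmf.finite_measure_finite_Union[symmetric])
        (auto simp: disjoint_family_on_def)
    then show "(\<Sum>g\<in>T. measure_pmf.prob (W k) (A' (act (inv g) z))) \<le> 1" by simp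
  qed (auto simp: M)
  finally show ?thesis .
qed

end

section \<open>Ping-pong and non-concentration\<close>

text \<open>\<open>C\<close> precedes \<open>D\<close>, so \<open>a\<close> and \<open>b\<close> can
  be taken long relative to their mutual products. The common time \<open>j\<close> makes all words
  with equally many letters \<open>a\<close>, \<open>b\<close> atoms of one convolution
  power.\<close>

locale schottky_walk = hyp_walk +
  assumes schottky: "\<exists>C. \<forall>D. \<exists>j a b. a \<in> set_pmf (walk_dist G \<mu> j) \<and> b \<in> set_pmf (walk_dist G \<mu> j) \<and> schottky_pair C D a b"
begin

lemma schottky_walk_inv: "schottky_walk G act x0 \<delta> (map_pmf (\<lambda>g. inv g) \<mu>) L"
proof unfold_locales
  show "set_pmf (map_pmf (\<lambda>g. inv g) \<mu>) \<subseteq> carrier G" using supp by auto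
  show "len g \<le> L" if "g \<in> set_pmf (map_pmf (\<lambda>g. inv g) \<mu>)" for g
    using that supp len_supp by auto
  obtain C where C: "\<And>D. \<exists>j a b. a \<in> set_pmf (W j) \<and> b \<in> set_pmf (W j) \<and> schottky_pair C D a b"
    using schottky by blast
  show "\<exists>C. \<forall>D. \<exists>j a b. a \<in> set_pmf (walk_dist G (map_pmf (\<lambda>g. inv g) \<mu>) j)
      \<and> b \<in> set_pmf (walk_dist G (map_pmf (\<lambda>g. inv g) \<mu>) j) \<and> schottky_pair C D a b"
  proof (intro exI[of _ C] allI)
    fix D
    obtain j a b where ab: "a \<in> set_pmf (W j)" "b \<in> set_pmf (W j)" "schottky_pair C D a b"
      using C[of D] by blast
    then have "schottky_pair C D (inv a) (inv b)" by (simp add: schottky_pair_inv walk_carrier)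
    with ab show "\<exists>j a b. a \<in> set_pmf (walk_dist G (map_pmf (\<lambda>g. inv g) \<mu>) j)
      \<and> b \<in> set_pmf (walk_dist G (map_pmf (\<lambda>g. inv g) \<mu>) j) \<and> schottky_pair C D a b"
      by (intro exI[of _ j] exI[of _ "inv a"] exI[of _ "inv b"]) (simp add: walk_inv)
  qed
qed

text \<open>Ping-pong, with \<open>T\<close> the words of length \<open>N\<close> in \<open>a\<close>, \<open>b\<close>; \<open>good z\<close> says that \<open>z\<close> lies outside
  the attracting shadows of \<open>a\<close> and \<open>b\<close>.\<close>

lemma spread_words:
  assumes a: "a \<in> set_pmf (W j)" and b: "b \<in> set_pmf (W j)"
    and D: "0 \<le> D" "D + 3 * c + 2 * \<delta> < len a" "D + 3 * c + 2 * \<delta> < len b" and "0 \<le> c - \<delta>"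
    and aa: "gromov_prod x0 (act a x0) (act (inv a) x0) \<le> c - \<delta>"
    and bb: "gromov_prod x0 (act b x0) (act (inv b) x0) \<le> c - \<delta>"
    and cross: "\<And>u v. u \<in> {a, inv a} \<Longrightarrow> v \<in> {b, inv b} \<Longrightarrow> gromov_prod x0 (act u x0) (act v x0) \<le> c - \<delta>"
  defines "good \<equiv> \<lambda>z. gromov_prod x0 z (act a x0) \<le> c \<and> gromov_prod x0 z (act b x0) \<le> c"
  shows "\<exists>T C'. finite T \<and> card T = 2 ^ N \<and> T \<subseteq> set_pmf (W (j * N)) \<and>
      (\<forall>z. good z \<longrightarrow> (\<forall>g\<in>T. good (act (inv g) z) \<and> (\<forall>g'\<in>T. g \<noteq> g' \<longrightarrow>
          gromov_prod x0 (act (inv g) z) (act (inv g') z) \<le> C' \<and>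
          2 * D < dist (act (inv g) z) (act (inv g') z))))"
proof (induction N)
  case 0
  show ?case by (intro exI[of _ "{\<one>}"]) auto
next
  case (Suc N)
  have aG: "a \<in> carrier G" and bG: "b \<in> carrier G" using a b by (auto simp: walk_carrier)
  \<comment> \<open>The ping-pong estimate: a point outside the shadow of \<open>act s x0\<close> is
    sent by \<open>inv s\<close> deep into the shadow of \<open>act (inv s) x0\<close>.\<close>
  have far: "len s - c \<le> gromov_prod x0 (act (inv s) z) (act (inv s) x0)"
    if "s \<in> carrier G" "gromov_prod x0 z (act s x0) \<le> c" for s z
    using that gromov_prod_flip[of x0 "act s x0" z]
    by (simp add: gromov_prod_act_inv gromov_prod_commute len_def)
  have avoid: "gromov_prod x0 (act (inv s) z) q \<le> c"
    if "s \<in> {a, b}" "gromov_prod x0 z (act s x0) \<le> c" "gromov_prod x0 (act (inv s) x0) q \<le> c - \<delta>" for s z q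
  proof -
    have "c - \<delta> + \<delta> < gromov_prod x0 (act (inv s) x0) (act (inv s) z)"
      using far[of s z] that aG bG D \<delta>_nonneg \<open>0 \<le> c - \<delta>\<close>
      by (subst gromov_prod_commute, elim insertE) auto
    from hyp_le_right[OF that(3) this] show ?thesis by simp
  qed
  have good_step: "good (act (inv s) z)" if "s \<in> {a, b}" "good z" for s z
    using that avoid[of s z] aa bb cross[of a "inv b"] cross[of "inv a" b]
    by (auto simp: good_def gromov_prod_commute)
  have sep: "gromov_prod x0 (act (inv a) z) (act (inv b) z') \<le> c + \<delta> \<and>
      2 * D < dist (act (inv a) z) (act (inv b) z')" if "good z" "good z'" for z z'
  proof -
    have fa: "len a - c \<le> gromov_prod x0 (act (inv a) z) (act (inv a) x0)"
      and fb: "len b - c \<le> gromov_prod x0 (act (inv b) z') (act (inv b) x0)"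
      using far that aG bG by (auto simp: good_def)
    have "gromov_prod x0 (act (inv a) z) (act (inv b) x0) \<le> c"
      using avoid[of a z] that cross[of "inv a" "inv b"] by (auto simp: good_def)
    moreover have "c + \<delta> < gromov_prod x0 (act (inv b) z') (act (inv b) x0)"
      using fb D \<delta>_nonneg \<open>0 \<le> c - \<delta>\<close> by linarith
    ultimately have gp: "gromov_prod x0 (act (inv a) z) (act (inv b) z') \<le> c + \<delta>"
      by (rule hyp_le_left)
    have "len a - c \<le> dist x0 (act (inv a) z)" "len b - c \<le> dist x0 (act (inv b) z')"
      using fa fb gromov_prod_le_left order_trans by blast+
    then show ?thesis using gp D \<delta>_nonneg \<open>0 \<le> c - \<delta>\<close> by (simp add: gromov_prod_def field_simps)
  qed
  obtain T C' where T: "finite T" "card T = 2 ^ N" "T \<subseteq> set_pmf (W (j * N))"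
    and all: "\<forall>z. good z \<longrightarrow> (\<forall>g\<in>T. good (act (inv g) z) \<and> (\<forall>g'\<in>T. g \<noteq> g' \<longrightarrow>
          gromov_prod x0 (act (inv g) z) (act (inv g') z) \<le> C' \<and>
          2 * D < dist (act (inv g) z) (act (inv g') z)))"
    using Suc by (elim exE conjE) (rule that)
  have TC: "good (act (inv g) z)" if "good z" "g \<in> T" for z g
    using all that by simp
  have TS: "gromov_prod x0 (act (inv g) z) (act (inv g') z) \<le> C' \<and>
        2 * D < dist (act (inv g) z) (act (inv g') z)"
    if "good z" "g \<in> T" "g' \<in> T" "g \<noteq> g'" for z g g'
    using all that by simp
  have TG: "T \<subseteq> carrier G" using T(3) walk_carrier by blast
  have inv_act: "act (inv (u \<otimes> s)) z = act (inv s) (act (inv u) z)" if "u \<in> T" "s \<in> {a, b}" for u s z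
    using that TG aG bG by (auto simp: inv_mult_group act_mult subset_iff)
  define T' where "T' = (\<lambda>u. u \<otimes> a) ` T \<union> (\<lambda>u. u \<otimes> b) ` T"
  \<comment> \<open>Words with different last letters obey the fixed bound
    \<open>c + \<delta>\<close>; with equal last letter \<open>s\<close> the old bound worsens by
    \<open>len s\<close>, a change of basepoint. The constant grows with \<open>N\<close> but not
    with \<open>z\<close>.\<close>
  define C'' where "C'' = max (c + \<delta>) (max (C' + len a) (C' + len b))"
  have sep_ab: "gromov_prod x0 (act (inv (u \<otimes> a)) z) (act (inv (u' \<otimes> b)) z) \<le> c + \<delta> \<and>
      2 * D < dist (act (inv (u \<otimes> a)) z) (act (inv (u' \<otimes> b)) z)" if "u \<in> T" "u' \<in> T" "good z" for u u' z
    using that sep TC by (simp add: inv_act)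
  have good0: "good x0" using \<open>0 \<le> c - \<delta>\<close> \<delta>_nonneg by (simp add: good_def gromov_prod_refl_left)
  have neq: "u \<otimes> a \<noteq> u' \<otimes> b" if "u \<in> T" "u' \<in> T" for u u'
    using sep_ab[OF that good0] D(1) by auto
  have inj: "inj_on (\<lambda>u. u \<otimes> s) T" if "s \<in> {a, b}" for s
    using that TG aG bG by (auto simp: inj_on_def subset_iff)
  have sep_same: "gromov_prod x0 (act (inv (u \<otimes> s)) z) (act (inv (u' \<otimes> s)) z) \<le> C' + len s \<and>
      2 * D < dist (act (inv (u \<otimes> s)) z) (act (inv (u' \<otimes> s)) z)"
    if "u \<in> T" "u' \<in> T" "u \<noteq> u'" "good z" "s \<in> {a, b}" for u u' z s
  proof -
    have sG: "s \<in> carrier G" using that aG bG by auto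
    have "gromov_prod x0 (act (inv s) (act (inv u) z)) (act (inv s) (act (inv u') z))
        \<le> gromov_prod x0 (act (inv u) z) (act (inv u') z) + len s"
      using sG gromov_prod_move_base[of "act s x0" "act (inv u) z" "act (inv u') z" x0]
      by (simp add: gromov_prod_act_inv len_def dist_commute)
    then show ?thesis using TS[of z u u'] that sG by (simp add: inv_act)
  qed
  show ?case
  proof (intro exI[of _ T'] exI[of _ C''] conjI allI impI ballI)
    show "finite T'" using T by (simp add: T'_def)
    have "card T' = card ((\<lambda>u. u \<otimes> a) ` T) + card ((\<lambda>u. u \<otimes> b) ` T)"
      unfolding T'_def using T(1) neq by (intro card_Un_disjoint) auto
    then show "card T' = 2 ^ Suc N" using inj by (simp add: card_image T(2))
    show "T' \<subseteq> set_pmf (W (j * Suc N))"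
      using T(3) a b walk_mult_mem[of _ "j * N" _ j] by (auto simp: T'_def add.commute)
    fix z g assume z: "good z" and g: "g \<in> T'"
    then obtain u s where "u \<in> T" "s \<in> {a, b}" "g = u \<otimes> s" by (auto simp: T'_def)
    then show "good (act (inv g) z)" using good_step[OF _ TC[OF z]] inv_act by simp
    fix g' assume g': "g' \<in> T'" and gg': "g \<noteq> g'"
    from g g' obtain u u' s s' where u: "u \<in> T" "u' \<in> T" "s \<in> {a, b}" "s' \<in> {a, b}"
      "g = u \<otimes> s" "g' = u' \<otimes> s'" by (auto simp: T'_def)
    have "gromov_prod x0 (act (inv g) z) (act (inv g') z) \<le> C'' \<and>
        2 * D < dist (act (inv g) z) (act (inv g') z)"
    proof (cases "s = s'")
      case True
      then have "u \<noteq> u'" using u gg' by auto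
      moreover have "C' + len s \<le> C''" using u(3) by (auto simp: C''_def le_max_iff_disj)
      ultimately show ?thesis using sep_same[of u u' z s] u z True by auto
    next
      case False
      then show ?thesis using sep_ab[of u u' z] sep_ab[of u' u z] u z
        by (auto simp: C''_def gromov_prod_commute dist_commute)
    qed
    then show "gromov_prod x0 (act (inv g) z) (act (inv g') z) \<le> C''"
      "2 * D < dist (act (inv g) z) (act (inv g') z)" by auto
  qed
qed

text \<open>The factor 2 makes balls of radius \<open>D\<close> around the positions disjoint; the
  bound \<open>C\<close> on products makes shadows deeper than \<open>C + \<delta>\<close>
  disjoint.\<close>

definition spreads :: "nat \<Rightarrow> real \<Rightarrow> real \<Rightarrow> real \<Rightarrow> nat \<Rightarrow> 'c \<Rightarrow> bool" where
  "spreads j \<theta> C D m z \<longleftrightarrow> (\<exists>T. finite T \<and> card T = m \<and> (\<forall>g\<in>T. \<theta> \<le> pmf (W j) g) \<and>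
      (\<forall>g\<in>T. \<forall>g'\<in>T. g \<noteq> g' \<longrightarrow> gromov_prod x0 (act (inv g) z) (act (inv g') z) \<le> C \<and>
          2 * D < dist (act (inv g) z) (act (inv g') z)))"

lemma spreadsE:
  assumes "spreads j \<theta> C D m z"
  obtains T where "finite T" "card T = m" "\<forall>g\<in>T. \<theta> \<le> pmf (W j) g"
    and "\<forall>g\<in>T. \<forall>g'\<in>T. g \<noteq> g' \<longrightarrow> gromov_prod x0 (act (inv g) z) (act (inv g') z) \<le> C \<and>
          2 * D < dist (act (inv g) z) (act (inv g') z)"
  using assms unfolding spreads_def by (elim exE conjE) (rule that)

text \<open>\<open>spread_words\<close> needs a good starting point. An arbitrary \<open>z\<close>
  cannot lie in the shadows of both \<open>act a x0\<close> and \<open>act b x0\<close>, so one of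
  \<open>inv a\<close>, \<open>inv b\<close> makes it good; the corresponding letter is put in front
  of every word.\<close>

lemma spread:
  assumes "0 \<le> D"
  shows "\<exists>j \<theta> C'. 0 < \<theta> \<and> (\<forall>z. spreads j \<theta> C' D (2 ^ N) z)"
proof -
  obtain C where C: "\<And>D. \<exists>j a b. a \<in> set_pmf (W j) \<and> b \<in> set_pmf (W j) \<and> schottky_pair C D a b"
    using schottky by blast
  define c where "c = C + \<delta>"
  obtain j a b where ab: "a \<in> set_pmf (W j)" "b \<in> set_pmf (W j)"
    and len: "D + 3 * c + 2 * \<delta> + 1 \<le> len a" "D + 3 * c + 2 * \<delta> + 1 \<le> len b"
    and gp: "gromov_prod x0 (act a x0) (act (inv a) x0) \<le> c - \<delta>" "gromov_prod x0 (act b x0) (act (inv b) x0) \<le> c - \<delta>"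
      "\<And>u v. u \<in> {a, inv a} \<Longrightarrow> v \<in> {b, inv b} \<Longrightarrow> gromov_prod x0 (act u x0) (act v x0) \<le> c - \<delta>"
    using C[of "D + 3 * c + 2 * \<delta> + 1"] unfolding schottky_pair_def c_def by auto
  have c: "0 \<le> c - \<delta>" using gp(1) gromov_prod_nonneg order_trans by blast
  have G: "a \<in> carrier G" "b \<in> carrier G" using ab by (auto simp: walk_carrier)
  let ?good = "\<lambda>z. gromov_prod x0 z (act a x0) \<le> c \<and> gromov_prod x0 z (act b x0) \<le> c"
  obtain T C' where T: "finite T" "card T = 2 ^ N" "T \<subseteq> set_pmf (W (j * N))"
    and TS: "\<And>z g g'. ?good z \<Longrightarrow> g \<in> T \<Longrightarrow> g' \<in> T \<Longrightarrow> g \<noteq> g' \<Longrightarrow>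
        gromov_prod x0 (act (inv g) z) (act (inv g') z) \<le> C' \<and>
        2 * D < dist (act (inv g) z) (act (inv g') z)"
    using spread_words[OF ab assms _ _ c gp, of N] len by force
  have TG: "T \<subseteq> carrier G" using T(3) walk_carrier by blast
  let ?J = "j + j * N"
  define F where "F = (\<lambda>u. a \<otimes> u) ` T \<union> (\<lambda>u. b \<otimes> u) ` T"
  \<comment> \<open>Both possible first letters enter \<open>F\<close>, so the weight does not
    depend on the one that \<open>z\<close> requires.\<close>
  define \<theta> where "\<theta> = Min (pmf (W ?J) ` F)"
  have "T \<noteq> {}" using T(2) by force
  then have F: "finite F" "F \<noteq> {}" "F \<subseteq> set_pmf (W ?J)"
    using T ab walk_mult_mem by (auto simp: F_def)
  have \<theta>: "0 < \<theta>" unfolding \<theta>_def using F by (subst Min_gr_iff) (auto simp: pmf_positive subset_iff)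
  have \<theta>_le: "\<theta> \<le> pmf (W ?J) g" if "g \<in> F" for g unfolding \<theta>_def using F that by (intro Min_le) auto
  have "\<exists>s\<in>{a, b}. ?good (act (inv s) z)" for z
  proof -
    have "gromov_prod x0 z (act a x0) \<le> c \<or> gromov_prod x0 z (act b x0) \<le> c"
      using hyp_min[of x0 "act a x0" z "act b x0"] gp(3)[of a b]
      by (auto simp: gromov_prod_commute min_def split: if_splits)
    then obtain s where s: "s \<in> {a, b}" "gromov_prod x0 z (act s x0) \<le> c" by auto
    have "len s - c \<le> gromov_prod x0 (act (inv s) z) (act (inv s) x0)"
      using s G gromov_prod_flip[of x0 "act s x0" z]
      by (auto simp: gromov_prod_act_inv gromov_prod_commute len_def)
    then have far: "c - \<delta> + \<delta> < gromov_prod x0 (act (inv s) x0) (act (inv s) z)"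
      using s len assms \<delta>_nonneg c by (subst gromov_prod_commute) auto
    have *: "gromov_prod x0 (act (inv s) z) q \<le> c" if "gromov_prod x0 (act (inv s) x0) q \<le> c - \<delta>" for q
      using hyp_le_right[OF that far] by simp
    have "?good (act (inv s) z)"
      using s(1) gp(1,2) gp(3)[of a "inv b"] gp(3)[of "inv a" b]
      by (intro conjI *) (auto simp: gromov_prod_commute)
    then show ?thesis using s(1) by blast
  qed note good_start = this
  have "spreads ?J \<theta> C' D (2 ^ N) z" for z
  proof -
    obtain s where s: "s \<in> {a, b}" "?good (act (inv s) z)" using good_start by blast
    then have sG: "s \<in> carrier G" using G by auto
    have inv_act: "act (inv (s \<otimes> u)) z = act (inv u) (act (inv s) z)" if "u \<in> T" for u
      using that TG sG by (auto simp: inv_mult_group act_mult subset_iff)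
    show ?thesis
      unfolding spreads_def
    proof (intro exI[of _ "(\<lambda>u. s \<otimes> u) ` T"] conjI ballI impI)
      have "inj_on (\<lambda>u. s \<otimes> u) T" using TG sG by (auto simp: inj_on_def subset_iff)
      then show "card ((\<lambda>u. s \<otimes> u) ` T) = 2 ^ N" using T(2) by (simp add: card_image)
      show "\<theta> \<le> pmf (W ?J) g" if "g \<in> (\<lambda>u. s \<otimes> u) ` T" for g
        using that s(1) by (intro \<theta>_le) (auto simp: F_def)
      fix g g' assume "g \<in> (\<lambda>u. s \<otimes> u) ` T" "g' \<in> (\<lambda>u. s \<otimes> u) ` T" and ne: "g \<noteq> g'"
      then obtain u u' where u: "u \<in> T" "u' \<in> T" and g: "g = s \<otimes> u" "g' = s \<otimes> u'" by auto
      with ne have "u \<noteq> u'" by auto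
      with TS[OF s(2)] u
      show "gromov_prod x0 (act (inv g) z) (act (inv g') z) \<le> C'"
        "2 * D < dist (act (inv g) z) (act (inv g') z)" by (simp_all add: g inv_act)
    qed (use T in simp)
  qed
  then show ?thesis using \<theta> by blast
qed

lemma spread_weight:
  assumes "finite T" "card T = m" "\<And>g. g \<in> T \<Longrightarrow> \<theta> \<le> pmf (W j) g"
  shows "real m * \<theta> \<le> 1"
proof -
  have "real m * \<theta> = (\<Sum>g\<in>T. \<theta>)" using assms(2) by simp
  also have "\<dots> \<le> sum (pmf (W j)) T" using assms(3) by (rule sum_mono)
  also have "\<dots> = measure_pmf.prob (W j) T" using assms(1) by (simp add: measure_measure_pmf_finite)
  finally show ?thesis using measure_pmf.prob_le_1 order_trans by blast
qed

text \<open>Every \<open>j\<close> letters contract the excess of the probability over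
  \<open>1 / real m\<close> by the factor \<open>1 - real m * \<theta>\<close>, at the price of
  lowering the depth by \<open>c\<close>. A fixed number \<open>t\<close> of rounds therefore
  suffices, and the depth lost stays bounded.\<close>

lemma shadow_decay:
  assumes "0 < \<eta>"
  shows "\<exists>R. \<forall>k z. measure_pmf.prob (W k) {w. R \<le> gromov_prod x0 z (act w x0)} \<le> \<eta>"
proof -
  obtain N where N: "(1 / 2) ^ N < \<eta> / 2" using assms real_arch_pow_inv[of "\<eta> / 2" "1 / 2"] by auto
  define m :: nat where "m = 2 ^ N"
  obtain j \<theta> C' where \<theta>: "0 < \<theta>" and spr: "\<forall>z. spreads j \<theta> C' 0 m z"
    using spread[OF order_refl, of N] unfolding m_def by blast
  have m\<theta>: "real m * \<theta> \<le> 1" using spr[rule_format, of x0] by (elim spreadsE) (rule spread_weight, auto)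
  have m0: "0 < real m" by (simp add: m_def)
  define c where "c = L * real j"
  define S where "S = (\<lambda>R z. {w. R \<le> gromov_prod x0 z (act w x0)})"
  have decay: "measure_pmf.prob (W k) (S R z) \<le> 1 / real m + (1 - real m * \<theta>) ^ t"
    if "C' + \<delta> + 1 + real t * c \<le> R" "t * j \<le> k" for t R k z
    using that
  proof (induction t arbitrary: R k z)
    case 0
    have "measure_pmf.prob (W k) (S R z) \<le> 1" by simp
    also have "1 \<le> 1 / real m + (1 - real m * \<theta>) ^ 0" using m0 by simp
    finally show ?case .
  next
    case (Suc t)
    define k' where "k' = k - j"
    have k: "k = j + k'" "t * j \<le> k'" using Suc.prems(2) by (auto simp: k'_def)
    have R': "C' + \<delta> + 1 + real t * c \<le> R - c" using Suc.prems(1) by (simp add: algebra_simps)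
    have c0: "0 \<le> c" using L_nonneg by (simp add: c_def)
    then have "0 \<le> real t * c" by simp
    with R' have R1: "C' + \<delta> < R - c" by linarith
    obtain T where T: "finite T" "card T = m" "\<forall>g\<in>T. \<theta> \<le> pmf (W j) g"
      and TS: "\<forall>g\<in>T. \<forall>g'\<in>T. g \<noteq> g' \<longrightarrow>
        gromov_prod x0 (act (inv g) z) (act (inv g') z) \<le> C' \<and>
          2 * 0 < dist (act (inv g) z) (act (inv g') z)"
      using spr[rule_format, of z] by (rule spreadsE)
    have "measure_pmf.prob (W (j + k')) (S R z)
        \<le> (1 - real (card T) * \<theta>) * (1 / real m + (1 - real m * \<theta>) ^ t) + \<theta>"
    proof (rule prob_walk_spread[where A' = "S (R - c)" and j = j])
      show "measure_pmf.prob (W k') (S (R - c) z) \<le> 1 / real m + (1 - real m * \<theta>) ^ t" for z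
        using Suc.IH R' k(2) by blast
      show "w \<in> S (R - c) (act (inv g) z)"
        if "g \<in> set_pmf (W j)" "w \<in> carrier G" "g \<otimes> w \<in> S R z" for g w z
      proof -
        have g: "g \<in> carrier G" using that walk_carrier by blast
        have "gromov_prod x0 z (act g (act w x0)) \<le> gromov_prod (act g x0) z (act g (act w x0)) + len g"
          using gromov_prod_move_base by (simp add: len_def)
        moreover have "len g \<le> c" unfolding c_def using that(1) by (rule walk_len)
        ultimately show ?thesis using that(2,3) g by (simp add: S_def gromov_prod_act_inv act_mult)
      qed
      show "S (R - c) (act (inv g) z) \<inter> S (R - c) (act (inv g') z) = {}"
        if "g \<in> T" "g' \<in> T" "g \<noteq> g'" for g g'
      proof -
        have "gromov_prod x0 (act (inv g) z) (act (inv g') z) \<le> C'" using TS that by blast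
        then have False if "R - c \<le> gromov_prod x0 (act (inv g) z) y"
            "R - c \<le> gromov_prod x0 (act (inv g') z) y" for y
          using hyp_min[of x0 "act (inv g) z" y "act (inv g') z"] that R1
          by (simp add: gromov_prod_commute[of x0 y] min_def split: if_splits)
        then show ?thesis by (auto simp: S_def)
      qed
    qed (use T \<theta> in auto)
    \<comment> \<open>\<open>1 / real m\<close> is the fixed point of the affine map given by the
      maximum principle.\<close>
    also have "\<dots> = 1 / real m + (1 - real m * \<theta>) ^ Suc t"
      using m0 by (simp add: T(2) field_simps)
    finally show ?case using k(1) by simp
  qed
  have "0 < real m * \<theta>" using m0 \<theta> by simp
  then obtain t where t: "(1 - real m * \<theta>) ^ t < \<eta> / 2"
    using m\<theta> assms real_arch_pow_inv[of "\<eta> / 2" "1 - real m * \<theta>"] by auto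
  have bound: "1 / real m + (1 - real m * \<theta>) ^ t \<le> \<eta>"
    using N t by (simp add: m_def power_one_over)
  \<comment> \<open>The second entry handles times below \<open>t * j\<close>: the walk is then too
    close to \<open>x0\<close> to enter so deep a shadow.\<close>
  define R where "R = max (C' + \<delta> + 1 + real t * c) (L * real (t * j) + 1)"
  have "measure_pmf.prob (W k) (S R z) \<le> \<eta>" for k z
  proof (cases "t * j \<le> k")
    case True
    then show ?thesis using decay[of t R k z] bound by (simp add: R_def)
  next
    case False
    have "w \<notin> S R z" if "w \<in> set_pmf (W k)" for w
    proof -
      have "gromov_prod x0 z (act w x0) \<le> len w" unfolding len_def by (rule gromov_prod_le_right)
      also have "\<dots> \<le> L * real k" using that by (rule walk_len)
      also have "\<dots> \<le> L * real (t * j)" using False L_nonneg by (intro mult_left_mono) (simp_all del: of_nat_mult)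
      also have "\<dots> < R" by (simp add: R_def)
      finally show ?thesis by (simp add: S_def)
    qed
    then have "measure_pmf.prob (W k) (S R z) \<le> measure_pmf.prob (W k) {}"
      by (intro prob_mono_pmf) auto
    then show ?thesis using assms by simp
  qed
  then show ?thesis by (auto simp: S_def)
qed

text \<open>Isometries carry balls to balls of the same radius, so no depth is lost here; four
  disjoint balls give the limit 1/4, leaving room for 1/2.\<close>

lemma ball_decay:
  assumes "0 \<le> D"
  shows "\<exists>k. \<forall>z. measure_pmf.prob (W k) {w. dist z (act w x0) \<le> D} \<le> 1 / 2"
proof -
  define m :: nat where "m = 2 ^ 2"
  obtain j \<theta> C' where \<theta>: "0 < \<theta>" and spr: "\<forall>z. spreads j \<theta> C' D m z"
    using spread[OF assms, of 2] unfolding m_def by blast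
  have m\<theta>: "4 * \<theta> \<le> 1"
  proof -
    have "real m * \<theta> \<le> 1"
      using spr[rule_format, of x0] by (elim spreadsE) (rule spread_weight, auto)
    then show ?thesis by (simp add: m_def)
  qed
  define S where "S = (\<lambda>z. {w. dist z (act w x0) \<le> D})"
  have decay: "measure_pmf.prob (W (t * j)) (S z) \<le> 1 / 4 + (1 - 4 * \<theta>) ^ t" for t z
  proof (induction t arbitrary: z)
    case 0
    have "measure_pmf.prob (W (0 * j)) (S z) \<le> 1" by (rule measure_pmf.prob_le_1)
    also have "1 \<le> 1 / 4 + (1 - 4 * \<theta>) ^ 0" by simp
    finally show ?case .
  next
    case (Suc t)
    obtain T where T: "finite T" "card T = m" "\<forall>g\<in>T. \<theta> \<le> pmf (W j) g"
      and TS: "\<forall>g\<in>T. \<forall>g'\<in>T. g \<noteq> g' \<longrightarrow>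
        gromov_prod x0 (act (inv g) z) (act (inv g') z) \<le> C' \<and>
          2 * D < dist (act (inv g) z) (act (inv g') z)"
      using spr[rule_format, of z] by (rule spreadsE)
    have "measure_pmf.prob (W (j + t * j)) (S z)
        \<le> (1 - real (card T) * \<theta>) * (1 / 4 + (1 - 4 * \<theta>) ^ t) + \<theta>"
    proof (rule prob_walk_spread[where A' = S and j = j, OF Suc.IH])
      show "w \<in> S (act (inv g) z)"
        if "g \<in> set_pmf (W j)" "w \<in> carrier G" "g \<otimes> w \<in> S z" for g w z
        using that walk_carrier[OF that(1)] by (simp add: S_def act_mult dist_act_inv dist_commute)
      show "S (act (inv g) z) \<inter> S (act (inv g') z) = {}" if "g \<in> T" "g' \<in> T" "g \<noteq> g'" for g g'
      proof -
        have "2 * D < dist (act (inv g) z) (act (inv g') z)" using TS that by blast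
        then have False if "dist (act (inv g) z) y \<le> D" "dist (act (inv g') z) y \<le> D" for y
          using dist_triangle2[of "act (inv g) z" "act (inv g') z" y] that by linarith
        then show ?thesis by (auto simp: S_def)
      qed
    qed (use T \<theta> in auto)
    also have "\<dots> = 1 / 4 + (1 - 4 * \<theta>) ^ Suc t" by (simp add: T(2) m_def field_simps)
    finally show ?case by simp
  qed
  obtain t where "(1 - 4 * \<theta>) ^ t < 1 / 4"
    using m\<theta> \<theta> real_arch_pow_inv[of "1 / 4" "1 - 4 * \<theta>"] by auto
  then have "measure_pmf.prob (W (t * j)) (S z) \<le> 1 / 2" for z using decay[of t z] by simp
  then show ?thesis by (auto simp: S_def)
qed

end

section \<open>Linear drift\<close>

lemma integrable_indicator_pmf [simp]: "integrable (measure_pmf p) (indicator A :: 'b \<Rightarrow> real)"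
  by (rule integrable_pmf_bounded[where B = 1]) (simp add: indicator_def)

lemma expectation_swap_pmf:
  fixes f :: "'b \<Rightarrow> 'c \<Rightarrow> real"
  assumes "\<And>x y. x \<in> set_pmf p \<Longrightarrow> y \<in> set_pmf q \<Longrightarrow> \<bar>f x y\<bar> \<le> B"
  shows "measure_pmf.expectation p (\<lambda>x. measure_pmf.expectation q (f x))
       = measure_pmf.expectation q (\<lambda>y. measure_pmf.expectation p (\<lambda>x. f x y))"
proof -
  have "measure_pmf.expectation (bind_pmf p (\<lambda>x. map_pmf (Pair x) q)) (case_prod f)
      = measure_pmf.expectation p (\<lambda>x. measure_pmf.expectation q (f x))"
    using assms by (subst expectation_bind_pmf[where B = B]) auto
  moreover have "measure_pmf.expectation (bind_pmf q (\<lambda>y. map_pmf (\<lambda>x. (x, y)) p)) (case_prod f)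
      = measure_pmf.expectation q (\<lambda>y. measure_pmf.expectation p (\<lambda>x. f x y))"
    using assms by (subst expectation_bind_pmf[where B = B]) auto
  moreover have "bind_pmf p (\<lambda>x. map_pmf (Pair x) q) = bind_pmf q (\<lambda>y. map_pmf (\<lambda>x. (x, y)) p)"
    unfolding map_pmf_def by (rule bind_commute_pmf)
  ultimately show ?thesis by simp
qed

lemma prob_pair_pmf:
  "measure_pmf.prob (pair_pmf p q) S = measure_pmf.expectation p (\<lambda>x. measure_pmf.prob q {y. (x, y) \<in> S})"
  unfolding pair_pmf_def by (simp add: prob_bind_pmf map_pmf_def[symmetric] vimage_def)

lemma prob_pair_pmf_le:
  assumes "\<And>x. x \<in> set_pmf p \<Longrightarrow> measure_pmf.prob q {y. (x, y) \<in> S} \<le> c"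
  shows "measure_pmf.prob (pair_pmf p q) S \<le> c"
  unfolding prob_pair_pmf using assms by (intro expectation_le_const_pmf[where B = 1]) auto

lemma prob_pair_pmf_le':
  assumes "\<And>y. y \<in> set_pmf q \<Longrightarrow> measure_pmf.prob p {x. (x, y) \<in> S} \<le> c"
  shows "measure_pmf.prob (pair_pmf p q) S \<le> c"
proof -
  have "measure_pmf.prob (pair_pmf p q) S = measure_pmf.prob (pair_pmf q p) {(y, x). (x, y) \<in> S}"
    by (subst pair_commute_pmf) (simp add: vimage_def case_prod_unfold)
  also have "\<dots> \<le> c" using assms by (intro prob_pair_pmf_le) simp
  finally show ?thesis .
qed

lemma exp_le_quadratic:
  fixes x :: real
  assumes "x \<le> 1 / 2"
  shows "exp x \<le> 1 + x + 2 * x\<^sup>2"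
proof -
  have "1 - x \<le> exp (- x)" using exp_ge_add_one_self[of "- x"] by simp
  then have "exp x * (1 - x) \<le> exp x * exp (- x)" by (intro mult_left_mono) auto
  then have "exp x * (1 - x) \<le> 1" by (simp add: exp_minus)
  also have "1 \<le> (1 + x + 2 * x\<^sup>2) * (1 - x)"
  proof -
    have "0 \<le> x\<^sup>2 * (1 - 2 * x)" using assms by (intro mult_nonneg_nonneg) auto
    then show ?thesis by (simp add: power2_eq_square algebra_simps)
  qed
  finally show ?thesis using assms by simp
qed

section \<open>From non-concentration to drift\<close>

context schottky_walk
begin

lemma shadow_decay_nonneg:
  assumes "0 < \<eta>"
  shows "\<exists>R\<ge>0. \<forall>k z. measure_pmf.prob (W k) {w. R \<le> gromov_prod x0 z (act w x0)} \<le> \<eta> \<and>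
     measure_pmf.prob (W k) {w. R \<le> gromov_prod x0 z (act (inv w) x0)} \<le> \<eta>"
proof -
  interpret rev: schottky_walk G act x0 \<delta> "map_pmf (\<lambda>g. inv g) \<mu>" L by (rule schottky_walk_inv)
  obtain R1 where R1: "\<And>k z. measure_pmf.prob (W k) {w. R1 \<le> gromov_prod x0 z (act w x0)} \<le> \<eta>"
    using shadow_decay[OF assms] by blast
  obtain R2 where R2: "\<And>k z. measure_pmf.prob (rev.W k) {w. R2 \<le> gromov_prod x0 z (act w x0)} \<le> \<eta>"
    using rev.shadow_decay[OF assms] by blast
  have R2': "measure_pmf.prob (W k) {w. R2 \<le> gromov_prod x0 z (act (inv w) x0)} \<le> \<eta>" for k z
    using R2[of k z] by (simp add: walk_inv vimage_def)
  define R where "R = max 0 (max R1 R2)"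
  have "measure_pmf.prob (W k) {w. R \<le> gromov_prod x0 z (act w x0)} \<le> \<eta>" for k z
    using R1[of k z] prob_mono_pmf[of "W k" "{w. R \<le> gromov_prod x0 z (act w x0)}"
        "{w. R1 \<le> gromov_prod x0 z (act w x0)}"] by (auto simp: R_def)
  moreover have "measure_pmf.prob (W k) {w. R \<le> gromov_prod x0 z (act (inv w) x0)} \<le> \<eta>" for k z
    using R2'[of k z] prob_mono_pmf[of "W k" "{w. R \<le> gromov_prod x0 z (act (inv w) x0)}"
        "{w. R2 \<le> gromov_prod x0 z (act (inv w) x0)}"] by (auto simp: R_def)
  moreover have "0 \<le> R" by (simp add: R_def)
  ultimately show ?thesis by blast
qed

lemma expectation_le_tail:
  fixes g :: "'a \<Rightarrow> real"
  assumes g: "\<And>w. w \<in> set_pmf p \<Longrightarrow> 0 \<le> g w" "\<And>w. w \<in> set_pmf p \<Longrightarrow> g w \<le> B"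
    and "0 \<le> R" and tail: "measure_pmf.prob p {w. R \<le> g w} \<le> \<eta>"
  shows "measure_pmf.expectation p g \<le> R + \<eta> * B"
proof -
  have B: "0 \<le> B" using g set_pmf_not_empty[of p] by (meson ex_in_conv order_trans)
  have "measure_pmf.expectation p g \<le> measure_pmf.expectation p (\<lambda>w. R + B * indicator {w. R \<le> g w} w)"
    using g B \<open>0 \<le> R\<close> by (intro expectation_mono_pmf[where B = B and B' = "R + B"])
      (force simp: indicator_def)+
  also have "\<dots> = R + B * measure_pmf.prob p {w. R \<le> g w}"
    by (subst Bochner_Integration.integral_add) simp_all
  also have "\<dots> \<le> R + B * \<eta>" using tail B by (intro add_left_mono mult_left_mono)
  finally show ?thesis by (simp add: mult.commute)
qed

text \<open>\<open>len (x \<otimes> y)\<close> is \<open>len x + len y\<close> minus twice a product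
  of \<open>act y x0\<close> and \<open>act (inv x) x0\<close>. For fixed \<open>y\<close> this
  product has mean at most \<open>R + len y / 4\<close> over \<open>x\<close>, by shadow decay for
  the inverse walk, so on average at least \<open>len y / 2 - 2 * R\<close> is gained.\<close>

lemma expected_len_growth: "\<exists>j>0. \<forall>q. 2 * real q \<le> measure_pmf.expectation (W (j * q)) len"
proof -
  obtain R where R: "0 \<le> R" and tail:
    "\<And>k z. measure_pmf.prob (W k) {w. R \<le> gromov_prod x0 z (act (inv w) x0)} \<le> 1 / 4"
    using shadow_decay_nonneg[of "1 / 4"] by auto
  \<comment> \<open>Leaving the ball of radius \<open>D\<close> with probability at least 1/2 gives
    mean length at least \<open>4 * R + 4\<close>, hence a gain of at least 2 per \<open>j\<close>
    letters.\<close>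
  define D where "D = 2 * (4 * R + 4)"
  have D: "0 < D" using R by (simp add: D_def)
  obtain j where "\<forall>z. measure_pmf.prob (W j) {w. dist z (act w x0) \<le> D} \<le> 1 / 2"
    using ball_decay[of D] D by auto
  then have j: "measure_pmf.prob (W j) {w. len w \<le> D} \<le> 1 / 2" by (simp add: len_def)
  have "j \<noteq> 0"
  proof
    assume "j = 0"
    moreover have "measure_pmf.prob (W 0) {w. len w \<le> D} = 1" using D by simp
    ultimately show False using j by simp
  qed
  have len_bdd: "\<bar>len w\<bar> \<le> L * real k" if "w \<in> set_pmf (W k)" for w k
    using walk_len[OF that] by simp
  have "D / 2 \<le> D * (1 - measure_pmf.prob (W j) {w. len w \<le> D})"
    using j D by (simp add: field_simps)
  also have "\<dots> = measure_pmf.expectation (W j) (\<lambda>w. D - D * indicator {w. len w \<le> D} w)"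
    by (subst Bochner_Integration.integral_diff) (simp_all add: algebra_simps)
  also have "\<dots> \<le> measure_pmf.expectation (W j) len"
    using D len_bdd by (intro expectation_mono_pmf[where B = D and B' = "L * real j"])
      (auto simp: indicator_def)
  finally have Ej: "4 * R + 4 \<le> measure_pmf.expectation (W j) len" by (simp add: D_def)
  have step: "measure_pmf.expectation (W k) len + 2 \<le> measure_pmf.expectation (W (k + j)) len" for k
  proof -
    have bdd: "\<bar>len (x \<otimes> y)\<bar> \<le> L * real (k + j)" if "x \<in> set_pmf (W k)" "y \<in> set_pmf (W j)" for x y
      using len_bdd walk_mult_mem[OF that] by blast
    have inner: "measure_pmf.expectation (W k) len + len y / 2 - 2 * R
        \<le> measure_pmf.expectation (W k) (\<lambda>x. len (x \<otimes> y))" if y: "y \<in> set_pmf (W j)" for y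
    proof -
      let ?g = "\<lambda>x. gromov_prod x0 (act y x0) (act (inv x) x0)"
      have g_le: "0 \<le> ?g x" "?g x \<le> len y" for x
        using gromov_prod_nonneg gromov_prod_le_left by (auto simp: len_def)
      have yG: "y \<in> carrier G" using y by (rule walk_carrier)
      have "len (x \<otimes> y) = len x + (len y - 2 * ?g x)" if "x \<in> set_pmf (W k)" for x
        using walk_carrier[OF that] yG by (simp add: gromov_prod_def len_def act_mult dist_act_inv dist_commute field_simps)
      then have "measure_pmf.expectation (W k) (\<lambda>x. len (x \<otimes> y))
          = measure_pmf.expectation (W k) (\<lambda>x. len x + (len y - 2 * ?g x))"
        by (intro integral_cong_AE) (auto simp: AE_measure_pmf_iff)
      also have "\<dots> = measure_pmf.expectation (W k) len + (len y - 2 * measure_pmf.expectation (W k) ?g)"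
      proof -
        have "integrable (measure_pmf (W k)) len"
          using len_bdd by (rule integrable_pmf_bounded)
        moreover have "integrable (measure_pmf (W k)) ?g"
          using g_le by (intro integrable_pmf_bounded[where B = "len y"]) simp
        ultimately show ?thesis by simp
      qed
      finally have "measure_pmf.expectation (W k) (\<lambda>x. len (x \<otimes> y))
          = measure_pmf.expectation (W k) len + (len y - 2 * measure_pmf.expectation (W k) ?g)" .
      moreover have "measure_pmf.expectation (W k) ?g \<le> R + 1 / 4 * len y"
        using g_le R tail by (intro expectation_le_tail)
      ultimately show ?thesis by simp
    qed
    have intj: "integrable (measure_pmf (W j)) len"
      using len_bdd by (rule integrable_pmf_bounded)
    have "measure_pmf.expectation (W k) len + 2
        \<le> measure_pmf.expectation (W k) len + measure_pmf.expectation (W j) len / 2 - 2 * R"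
      using Ej by simp
    also have "\<dots> = measure_pmf.expectation (W j) (\<lambda>y. measure_pmf.expectation (W k) len + len y / 2 - 2 * R)"
      using intj by simp
    also have "\<dots> \<le> measure_pmf.expectation (W j) (\<lambda>y. measure_pmf.expectation (W k) (\<lambda>x. len (x \<otimes> y)))"
    proof (rule expectation_mono_pmf[OF _ _ inner])
      show "\<bar>measure_pmf.expectation (W k) (\<lambda>x. len (x \<otimes> y))\<bar> \<le> L * real (k + j)"
        if "y \<in> set_pmf (W j)" for y
        using expectation_le_const_pmf[of "W k" "\<lambda>x. len (x \<otimes> y)" "L * real (k + j)" "L * real (k + j)"]
          expectation_ge_const_pmf[of "W k" "\<lambda>x. len (x \<otimes> y)" "L * real (k + j)" 0] bdd that by force
      show "\<bar>measure_pmf.expectation (W k) len + len y / 2 - 2 * R\<bar>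
          \<le> \<bar>measure_pmf.expectation (W k) len\<bar> + L * real j + 2 * R" if "y \<in> set_pmf (W j)" for y
        using len_bdd[OF that] len_nonneg[of y] R by linarith
    qed
    also have "\<dots> = measure_pmf.expectation (W k) (\<lambda>x. measure_pmf.expectation (W j) (\<lambda>y. len (x \<otimes> y)))"
      using bdd by (rule expectation_swap_pmf[symmetric])
    also have "\<dots> = measure_pmf.expectation (W (k + j)) len"
      using bdd by (rule expectation_walk_add[symmetric])
    finally show ?thesis .
  qed
  have "2 * real q \<le> measure_pmf.expectation (W (j * q)) len" for q
  proof (induction q)
    case 0
    show ?case by (simp add: integral_nonneg)
  next
    case (Suc q)
    then show ?case using step[of "j * q"] by (simp add: add.commute)
  qed
  then show ?thesis using \<open>j \<noteq> 0\<close> by blast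
qed

text \<open>A Busemann-type cocycle (\<open>displacement_mult\<close>): estimates uniform in
  \<open>z\<close> can be iterated, because later letters only see a translated
  \<open>z\<close>.\<close>

definition displacement :: "'c \<Rightarrow> 'a \<Rightarrow> real" where
  "displacement z w = dist z (act w x0) - dist z x0"

lemma displacement_abs: "\<bar>displacement z w\<bar> \<le> len w"
  using dist_triangle[of z "act w x0" x0] dist_triangle[of z x0 "act w x0"]
  by (simp add: displacement_def len_def dist_commute)

lemma displacement_walk: "w \<in> set_pmf (W k) \<Longrightarrow> \<bar>displacement z w\<bar> \<le> L * real k"
  using displacement_abs walk_len order_trans by blast

lemma displacement_mult:
  "x \<in> carrier G \<Longrightarrow> y \<in> carrier G \<Longrightarrow>
    displacement z (x \<otimes> y) = displacement z x + displacement (act (inv x) z) y"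
  by (simp add: displacement_def act_mult dist_act_inv dist_commute)

text \<open>\<open>displacement z w\<close> is \<open>len w\<close> minus twice a product. The
  choice of \<eta> bounds the doubled mean product at time \<open>j * q\<close> by
  \<open>2 * R + q\<close> against a mean length of at least \<open>2 * q\<close>; as
  \<open>R\<close> depends on \<eta> but not on \<open>q\<close>, a large \<open>q\<close>
  wins.\<close>

lemma expected_drift: "\<exists>k. \<forall>z. 1 \<le> measure_pmf.expectation (W k) (displacement z)"
proof -
  obtain j where j: "0 < j" "\<And>q. 2 * real q \<le> measure_pmf.expectation (W (j * q)) len"
    using expected_len_growth by blast
  define \<eta> where "\<eta> = 1 / (2 * (L * real j + 1))"
  have Lj: "0 \<le> L * real j" using L_nonneg by simp
  then have \<eta>: "0 < \<eta>" by (simp add: \<eta>_def)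
  obtain R where R: "0 \<le> R"
    and tail: "\<And>k z. measure_pmf.prob (W k) {w. R \<le> gromov_prod x0 z (act w x0)} \<le> \<eta>"
    using shadow_decay_nonneg[OF \<eta>] by blast
  obtain q :: nat where q: "2 * R + 1 \<le> real q" using real_arch_simple by blast
  have "1 \<le> measure_pmf.expectation (W (j * q)) (displacement z)" for z
  proof -
    let ?k = "j * q"
    let ?g = "\<lambda>w. gromov_prod x0 z (act w x0)"
    have g_le: "0 \<le> ?g w" "?g w \<le> len w" for w
      using gromov_prod_nonneg gromov_prod_le_right by (auto simp: len_def)
    have len_bdd: "len w \<le> L * real ?k" if "w \<in> set_pmf (W ?k)" for w
      using that by (rule walk_len)
    have "measure_pmf.expectation (W ?k) ?g \<le> R + \<eta> * (L * real ?k)"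
      using g_le len_bdd R tail order_trans by (intro expectation_le_tail) blast+
    also have "\<eta> * (L * real ?k) = real q * (L * real j / (L * real j + 1)) / 2"
      using Lj by (simp add: \<eta>_def field_simps)
    also have "\<dots> \<le> real q * 1 / 2"
      using Lj by (intro divide_right_mono mult_left_mono) auto
    finally have Eg: "2 * measure_pmf.expectation (W ?k) ?g \<le> 2 * R + real q" by simp
    have "displacement z = (\<lambda>w. len w - 2 * ?g w)"
      by (rule ext) (simp add: displacement_def len_def gromov_prod_def dist_commute field_simps)
    then have "measure_pmf.expectation (W ?k) (displacement z)
        = measure_pmf.expectation (W ?k) (\<lambda>w. len w - 2 * ?g w)" by simp
    also have "\<dots> = measure_pmf.expectation (W ?k) len - 2 * measure_pmf.expectation (W ?k) ?g"
    proof -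
      have "integrable (measure_pmf (W ?k)) len"
        using len_bdd by (intro integrable_pmf_bounded[where B = "L * real ?k"]) simp
      moreover have "integrable (measure_pmf (W ?k)) ?g"
        using g_le len_bdd by (intro integrable_pmf_bounded[where B = "L * real ?k"])
          (metis abs_of_nonneg order_trans)
      ultimately show ?thesis by simp
    qed
    also have "\<dots> \<ge> 1" using Eg j(2)[of q] q by linarith
    finally show ?thesis .
  qed
  then show ?thesis by blast
qed

section \<open>Exponential estimates for the drift\<close>

lemma exponential_moment:
  "\<exists>k \<beta> \<rho>. 0 < k \<and> 0 < \<beta> \<and> 0 < \<rho> \<and> \<rho> < 1 \<and>
     (\<forall>z. measure_pmf.expectation (W k) (\<lambda>w. exp (- (\<beta> * displacement z w))) \<le> \<rho>)"
proof -
  obtain k where k: "\<And>z. 1 \<le> measure_pmf.expectation (W k) (displacement z)"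
    using expected_drift by blast
  have "k \<noteq> 0"
  proof
    assume "k = 0"
    with k[of x0] show False by (simp add: displacement_def)
  qed
  define b where "b = L * real k"
  have b: "0 \<le> b" using L_nonneg by (simp add: b_def)
  \<comment> \<open>Small enough for the quadratic error
    \<open>2 * \<beta>\<^sup>2 * b\<^sup>2\<close> to use up at most half of the mean gain \<beta>,
    and for \<open>exp_le_quadratic\<close> to apply.\<close>
  define \<beta> where "\<beta> = 1 / (4 * (b\<^sup>2 + 1))"
  have b2: "0 < b\<^sup>2 + 1" by (smt (verit) zero_le_power2)
  then have \<beta>: "0 < \<beta>" "\<beta> \<le> 1 / 4" by (auto simp: \<beta>_def field_simps)
  have \<beta>b: "\<beta> * b \<le> 1 / 2"
  proof -
    have "0 \<le> (b - 1)\<^sup>2" by simp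
    then have "2 * b \<le> b\<^sup>2 + 1" by (simp add: power2_eq_square algebra_simps)
    then show ?thesis using b2 b by (simp add: \<beta>_def field_simps)
  qed
  have \<beta>b2: "2 * \<beta>\<^sup>2 * b\<^sup>2 \<le> \<beta> / 2"
  proof -
    have "4 * \<beta> * b\<^sup>2 \<le> 1" using b2 by (simp add: \<beta>_def field_simps)
    then have "\<beta> * (4 * \<beta> * b\<^sup>2) \<le> \<beta> * 1" using \<beta> by (intro mult_left_mono) auto
    then show ?thesis by (simp add: power2_eq_square)
  qed
  have "measure_pmf.expectation (W k) (\<lambda>w. exp (- (\<beta> * displacement z w))) \<le> 1 - \<beta> / 2" for z
  proof -
    have d: "\<bar>displacement z w\<bar> \<le> b" if "w \<in> set_pmf (W k)" for w
      using displacement_walk[OF that] by (simp add: b_def)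
    have ld: "\<bar>\<beta> * displacement z w\<bar> \<le> \<beta> * b" if "w \<in> set_pmf (W k)" for w
      using d[OF that] \<beta> by (simp add: abs_mult)
    have "measure_pmf.expectation (W k) (\<lambda>w. exp (- (\<beta> * displacement z w)))
        \<le> measure_pmf.expectation (W k) (\<lambda>w. (1 + 2 * \<beta>\<^sup>2 * b\<^sup>2) - \<beta> * displacement z w)"
    proof (rule expectation_mono_pmf[where B = "exp (1 / 2)" and B' = "1 + 2 * \<beta>\<^sup>2 * b\<^sup>2 + \<beta> * b"])
      fix w assume w: "w \<in> set_pmf (W k)"
      show "\<bar>exp (- (\<beta> * displacement z w))\<bar> \<le> exp (1 / 2)" using ld[OF w] \<beta>b by simp
      have "0 \<le> 2 * \<beta>\<^sup>2 * b\<^sup>2" by simp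
      then show "\<bar>(1 + 2 * \<beta>\<^sup>2 * b\<^sup>2) - \<beta> * displacement z w\<bar> \<le> 1 + 2 * \<beta>\<^sup>2 * b\<^sup>2 + \<beta> * b"
        using ld[OF w] by linarith
      have "exp (- (\<beta> * displacement z w)) \<le> 1 + - (\<beta> * displacement z w) + 2 * (- (\<beta> * displacement z w))\<^sup>2"
        using ld[OF w] \<beta>b by (intro exp_le_quadratic) linarith
      moreover have "(- (\<beta> * displacement z w))\<^sup>2 \<le> (\<beta> * b)\<^sup>2"
        using ld[OF w] by (simp add: abs_le_square_iff[symmetric])
      ultimately show "exp (- (\<beta> * displacement z w)) \<le> (1 + 2 * \<beta>\<^sup>2 * b\<^sup>2) - \<beta> * displacement z w"
        by (simp add: power_mult_distrib)
    qed
    also have "\<dots> = (1 + 2 * \<beta>\<^sup>2 * b\<^sup>2) - \<beta> * measure_pmf.expectation (W k) (displacement z)"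
      using integrable_pmf_bounded[of "W k" "displacement z" b, OF d] by simp
    also have "\<dots> \<le> (1 + \<beta> / 2) - \<beta> * 1"
      using \<beta>b2 \<beta> k[of z] by (intro diff_mono add_mono mult_left_mono) auto
    finally show ?thesis by simp
  qed
  moreover have "0 < 1 - \<beta> / 2" "1 - \<beta> / 2 < 1" using \<beta> by auto
  ultimately show ?thesis using \<beta>(1) \<open>k \<noteq> 0\<close> by blast
qed

text \<open>The cocycle identity and uniformity in \<open>z\<close> make the exponential moments
  submultiplicative in time; Markov's inequality concludes. Only \<open>B\<close> depends on the
  level \<open>C\<close>.\<close>

lemma displacement_decay:
  "\<exists>k \<rho>. 0 < k \<and> 0 < \<rho> \<and> \<rho> < 1 \<and> (\<forall>C. \<exists>B>0. \<forall>t z.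
     measure_pmf.prob (W (k * t)) {w. displacement z w \<le> C} \<le> B * \<rho> ^ t)"
proof -
  obtain k \<beta> \<rho> where k: "0 < k" and \<beta>: "0 < \<beta>" and \<rho>: "0 < \<rho>" "\<rho> < 1"
    and m: "\<And>z. measure_pmf.expectation (W k) (\<lambda>w. exp (- (\<beta> * displacement z w))) \<le> \<rho>"
    using exponential_moment by blast
  let ?e = "\<lambda>z w. exp (- (\<beta> * displacement z w))"
  have bdd: "\<bar>?e z w\<bar> \<le> exp (\<beta> * (L * real n))" if "w \<in> set_pmf (W n)" for z w n
  proof -
    have "- displacement z w \<le> L * real n" using displacement_walk[OF that, of z] by linarith
    then have "\<beta> * - displacement z w \<le> \<beta> * (L * real n)" using \<beta> by (intro mult_left_mono) auto
    then show ?thesis by simp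
  qed
  have mt: "measure_pmf.expectation (W (k * t)) (?e z) \<le> \<rho> ^ t" for t z
  proof (induction t)
    case 0
    show ?case by (simp add: displacement_def)
  next
    case (Suc t)
    have "measure_pmf.expectation (W (k * t + k)) (?e z)
        = measure_pmf.expectation (W (k * t)) (\<lambda>x. measure_pmf.expectation (W k) (\<lambda>y. ?e z (x \<otimes> y)))"
      by (rule expectation_walk_add) (rule bdd, rule walk_mult_mem)
    also have "\<dots> = measure_pmf.expectation (W (k * t))
        (\<lambda>x. ?e z x * measure_pmf.expectation (W k) (?e (act (inv x) z)))"
    proof (intro integral_cong_AE; (simp add: AE_measure_pmf_iff)?)
      show "\<forall>x\<in>set_pmf (W (k * t)). measure_pmf.expectation (W k) (\<lambda>y. ?e z (x \<otimes> y))
         = ?e z x * measure_pmf.expectation (W k) (?e (act (inv x) z))"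
      proof
        fix x assume x: "x \<in> set_pmf (W (k * t))"
        have "measure_pmf.expectation (W k) (\<lambda>y. ?e z (x \<otimes> y))
            = measure_pmf.expectation (W k) (\<lambda>y. ?e z x * ?e (act (inv x) z) y)"
          by (intro integral_cong_AE)
             (auto simp: AE_measure_pmf_iff displacement_mult walk_carrier[OF x] walk_carrier
               exp_add[symmetric] distrib_left)
        then show "measure_pmf.expectation (W k) (\<lambda>y. ?e z (x \<otimes> y))
         = ?e z x * measure_pmf.expectation (W k) (?e (act (inv x) z))" by simp
      qed
    qed
    also have "\<dots> \<le> measure_pmf.expectation (W (k * t)) (\<lambda>x. ?e z x * \<rho>)"
    proof (rule expectation_mono_pmf)
      fix x assume x: "x \<in> set_pmf (W (k * t))"
      have nn: "0 \<le> measure_pmf.expectation (W k) (?e (act (inv x) z))" by (simp add: integral_nonneg)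
      show "?e z x * measure_pmf.expectation (W k) (?e (act (inv x) z)) \<le> ?e z x * \<rho>"
        using m by (intro mult_left_mono) auto
      moreover have "?e z x * \<rho> \<le> exp (\<beta> * (L * real (k * t))) * \<rho>"
        using bdd[OF x, of z] \<rho> by (intro mult_right_mono) auto
      ultimately show "\<bar>?e z x * measure_pmf.expectation (W k) (?e (act (inv x) z))\<bar> \<le> exp (\<beta> * (L * real (k * t))) * \<rho>"
        and "\<bar>?e z x * \<rho>\<bar> \<le> exp (\<beta> * (L * real (k * t))) * \<rho>"
        using nn \<rho> by (simp_all only: abs_mult abs_of_nonneg abs_exp_cancel)
    qed
    also have "\<dots> \<le> \<rho> ^ t * \<rho>" using Suc \<rho> by (simp add: mult_right_mono)
    finally show ?case by (simp add: add.commute mult.commute)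
  qed
  have "measure_pmf.prob (W (k * t)) {w. displacement z w \<le> C} \<le> exp (\<beta> * C) * \<rho> ^ t" for t z C
  proof -
    have "measure_pmf.prob (W (k * t)) {w. displacement z w \<le> C}
        = measure_pmf.expectation (W (k * t)) (indicator {w. displacement z w \<le> C})" by simp
    also have "\<dots> \<le> measure_pmf.expectation (W (k * t)) (\<lambda>w. exp (\<beta> * C) * ?e z w)"
    proof (rule expectation_mono_pmf[where B = 1])
      fix w assume w: "w \<in> set_pmf (W (k * t))"
      show "\<bar>exp (\<beta> * C) * ?e z w\<bar> \<le> exp (\<beta> * C) * exp (\<beta> * (L * real (k * t)))"
        using bdd[OF w, of z] by (simp add: abs_mult)
      show "indicator {w. displacement z w \<le> C} w \<le> exp (\<beta> * C) * ?e z w"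
        using \<beta> by (auto simp: indicator_def exp_add[symmetric] mult_left_mono)
    qed (simp add: indicator_def)
    also have "\<dots> = exp (\<beta> * C) * measure_pmf.expectation (W (k * t)) (?e z)" by simp
    also have "\<dots> \<le> exp (\<beta> * C) * \<rho> ^ t" using mt by (intro mult_left_mono) auto
    finally show ?thesis .
  qed
  then show ?thesis using k \<rho> exp_gt_zero by blast
qed

lemma displacement_decay_both:
  "\<exists>k \<rho>. 0 < k \<and> 0 < \<rho> \<and> \<rho> < 1 \<and> (\<forall>C. \<exists>B>0. \<forall>t z.
     measure_pmf.prob (W (k * t)) {w. displacement z w \<le> C} \<le> B * \<rho> ^ t \<and>
     measure_pmf.prob (W (k * t)) {w. displacement z (inv w) \<le> C} \<le> B * \<rho> ^ t)"
proof -
  interpret rev: schottky_walk G act x0 \<delta> "map_pmf (\<lambda>g. inv g) \<mu>" L by (rule schottky_walk_inv)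
  obtain k1 \<rho>1 where 1: "0 < k1" "0 < \<rho>1" "\<rho>1 < 1"
    and d1: "\<And>C. \<exists>B>0. \<forall>t z. measure_pmf.prob (W (k1 * t)) {w. displacement z w \<le> C} \<le> B * \<rho>1 ^ t"
    using displacement_decay by blast
  obtain k2 \<rho>2 where 2: "0 < k2" "0 < \<rho>2" "\<rho>2 < 1"
    and d2: "\<And>C. \<exists>B>0. \<forall>t z. measure_pmf.prob (rev.W (k2 * t)) {w. displacement z w \<le> C} \<le> B * \<rho>2 ^ t"
    using rev.displacement_decay unfolding rev.displacement_def displacement_def by blast
  define \<rho> where "\<rho> = max \<rho>1 \<rho>2"
  have \<rho>: "0 < \<rho>" "\<rho> < 1" using 1 2 by (auto simp: \<rho>_def)
  have "\<exists>B>0. \<forall>t z.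
     measure_pmf.prob (W (k1 * k2 * t)) {w. displacement z w \<le> C} \<le> B * \<rho> ^ t \<and>
     measure_pmf.prob (W (k1 * k2 * t)) {w. displacement z (inv w) \<le> C} \<le> B * \<rho> ^ t" for C
  proof -
    obtain B1 where B1: "0 < B1" "\<And>t z. measure_pmf.prob (W (k1 * t)) {w. displacement z w \<le> C} \<le> B1 * \<rho>1 ^ t"
      using d1 by blast
    obtain B2 where B2: "0 < B2" "\<And>t z. measure_pmf.prob (rev.W (k2 * t)) {w. displacement z w \<le> C} \<le> B2 * \<rho>2 ^ t"
      using d2 by blast
    have pow: "B' * \<rho>' ^ (k' * t) \<le> (B1 + B2) * \<rho> ^ t"
      if "0 < k'" "0 < \<rho>'" "\<rho>' \<le> \<rho>" "0 \<le> B'" "B' \<le> B1 + B2" for k' t :: nat and \<rho>' B'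
    proof -
      have "t \<le> k' * t" using that(1) by simp
      then have "\<rho>' ^ (k' * t) \<le> \<rho>' ^ t" using that \<rho> by (intro power_decreasing) auto
      also have "\<dots> \<le> \<rho> ^ t" using that by (intro power_mono) auto
      finally show ?thesis using that by (intro mult_mono) auto
    qed
    have "measure_pmf.prob (W (k1 * k2 * t)) {w. displacement z w \<le> C} \<le> (B1 + B2) * \<rho> ^ t" for t z
      using B1(2)[of "k2 * t" z] pow[of k2 \<rho>1 B1 t] 1 2 B1(1) B2(1)
      by (simp add: \<rho>_def mult.assoc)
    moreover have "measure_pmf.prob (W (k1 * k2 * t)) {w. displacement z (inv w) \<le> C} \<le> (B1 + B2) * \<rho> ^ t" for t z
      using B2(2)[of "k1 * t" z] pow[of k1 \<rho>2 B2 t] 1 2 B1(1) B2(1)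
      by (simp add: \<rho>_def walk_inv vimage_def mult.assoc mult.left_commute[of k2])
    moreover have "0 < B1 + B2" using B1(1) B2(1) by simp
    ultimately show ?thesis by blast
  qed
  moreover have "0 < k1 * k2" using 1 2 by simp
  ultimately show ?thesis using \<rho> by blast
qed

end

section \<open>Probability of WPD\<close>

context hyp_action
begin

text \<open>Up to conjugation \<open>X A f B Y\<close> is \<open>f B Y X A\<close>. The Gromov products at the two
  junctions with \<open>f\<close> are read off \<open>A\<close> and \<open>B\<close>, since the rest of the word does not
  cancel them.\<close>

lemma WPD_block:
  assumes G: "f \<in> carrier G" "A \<in> carrier G" "B \<in> carrier G" "X \<in> carrier G" "Y \<in> carrier G"
    and "0 \<le> R" and C: "2 * (2 * (R + \<delta>) + 10 * \<delta> + 1) \<le> C"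
    and lf: "2 * (R + \<delta>) + 10 * \<delta> + 1 \<le> len f"
    and fin: "finite (Stab G act (4 * (R + \<delta>) + 18 * \<delta> + 1) x0 (act f x0))"
    and gB: "gromov_prod x0 (act (inv f) x0) (act B x0) \<le> R"
    and gA: "gromov_prod x0 (act f x0) (act (inv A) x0) \<le> R"
    and dB: "C < dist (act (Y \<otimes> X \<otimes> A) x0) (act (inv B) x0) - dist (act (Y \<otimes> X \<otimes> A) x0) x0"
    and dA: "C < dist (act (inv (B \<otimes> Y \<otimes> X)) x0) (act A x0) - dist (act (inv (B \<otimes> Y \<otimes> X)) x0) x0"
  shows "WPD G act x0 (X \<otimes> (A \<otimes> (f \<otimes> (B \<otimes> Y))))"
proof -
  define v where "v = B \<otimes> (Y \<otimes> X \<otimes> A)"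
  have v: "v \<in> carrier G" using G by (simp add: v_def)
  \<comment> \<open>If \<open>inv u\<close> leads away from \<open>z\<close> by more than
    \<open>C\<close>, the directions of \<open>act u x0\<close> and \<open>act u z\<close> agree to
    depth above \<open>C / 2\<close>, so at a junction the long remainder may be replaced by its
    adjacent factor.\<close>
  have far: "C / 2 < gromov_prod x0 (act u x0) (act u z)"
    if "u \<in> carrier G" "C < dist z (act (inv u) x0) - dist z x0" for u z
  proof -
    have "gromov_prod x0 (act u x0) (act u z) = (len u + dist z (act (inv u) x0) - dist z x0) / 2"
      using that(1) by (simp add: gromov_prod_def len_def dist_act_inv dist_commute)
    moreover have "C < len u + (dist z (act (inv u) x0) - dist z x0)"
      using that(2) len_nonneg[of u] by linarith
    ultimately show ?thesis by simp
  qed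
  have far_B: "C / 2 < gromov_prod x0 (act B x0) (act v x0)"
    using far[OF G(3) dB] G by (simp add: v_def act_mult)
  have "inv v = inv A \<otimes> inv (B \<otimes> Y \<otimes> X)"
    using G by (simp add: v_def m_assoc inv_mult_group)
  then have far_A: "C / 2 < gromov_prod x0 (act (inv A) x0) (act (inv v) x0)"
    using far[of "inv A" "act (inv (B \<otimes> Y \<otimes> X)) x0"] dA G by (simp add: act_mult)
  have C': "R + \<delta> < C / 2" using C \<open>0 \<le> R\<close> \<delta>_nonneg by (simp add: field_simps)
  have "WPD G act x0 (f \<otimes> v)"
  proof (rule WPD_criterion[OF G(1) v _ _ _ lf _ fin])
    show "0 \<le> R + \<delta>" using \<open>0 \<le> R\<close> \<delta>_nonneg by simp
    have "R + \<delta> < gromov_prod x0 (act v x0) (act B x0)"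
      using far_B C' by (simp add: gromov_prod_commute[of x0 "act v x0"])
    with hyp_le_left[OF gB] show "gromov_prod x0 (act (inv f) x0) (act v x0) \<le> R + \<delta>" by simp
    have "R + \<delta> < gromov_prod x0 (act (inv v) x0) (act (inv A) x0)"
      using far_A C' by (simp add: gromov_prod_commute[of x0 "act (inv v) x0"])
    with hyp_le_left[OF gA] show "gromov_prod x0 (act (inv v) x0) (act f x0) \<le> R + \<delta>"
      by (simp add: gromov_prod_commute[of x0 "act (inv v) x0"])
    show "2 * (R + \<delta>) + 10 * \<delta> + 1 \<le> len v"
      using gromov_prod_le_right[of x0 "act B x0" "act v x0"] far_B C by (simp add: len_def)
  qed
  from WPD_conjugate[OF this, of "X \<otimes> A"]
  have "WPD G act x0 (X \<otimes> A \<otimes> (f \<otimes> v) \<otimes> inv (X \<otimes> A))" using G by simp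
  moreover have "X \<otimes> A \<otimes> (f \<otimes> v) = X \<otimes> (A \<otimes> (f \<otimes> (B \<otimes> Y))) \<otimes> (X \<otimes> A)"
    using G by (simp add: v_def m_assoc)
  ultimately show ?thesis using G by (simp add: m_assoc)
qed

end

section \<open>Recursion over blocks\<close>

context schottky_walk
begin

text \<open>Failure of WPD requires a locally bad block followed by another failure, or interference
  with the rest of the word. The first contributes the factor on \<open>u\<close>, each of the two
  interference events at most \<beta>.\<close>

lemma not_WPD_recursion:
  assumes f: "f \<in> set_pmf (W p)"
    and "0 \<le> R" and C: "2 * (2 * (R + \<delta>) + 10 * \<delta> + 1) \<le> C"
    and lf: "2 * (R + \<delta>) + 10 * \<delta> + 1 \<le> len f"
    and fin: "finite (Stab G act (4 * (R + \<delta>) + 18 * \<delta> + 1) x0 (act f x0))"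
    and tail: "\<And>k z. measure_pmf.prob (W k) {w. R \<le> gromov_prod x0 z (act w x0)} \<le> 1 / 2"
      "\<And>k z. measure_pmf.prob (W k) {w. R \<le> gromov_prod x0 z (act (inv w) x0)} \<le> 1 / 2"
    and disp: "\<And>z. measure_pmf.prob (W r) {w. displacement z w \<le> C} \<le> \<beta>"
      "\<And>z. measure_pmf.prob (W r) {w. displacement z (inv w) \<le> C} \<le> \<beta>"
    and u: "\<And>X. X \<in> carrier G \<Longrightarrow> measure_pmf.prob (W n) {w. \<not> WPD G act x0 (X \<otimes> w)} \<le> u"
    and X: "X \<in> carrier G"
  shows "measure_pmf.prob (W (r + (p + (r + n)))) {w. \<not> WPD G act x0 (X \<otimes> w)}
     \<le> (1 - pmf (W p) f / 4) * u + 2 * \<beta>"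
proof -
  have fG: "f \<in> carrier G" using f by (rule walk_carrier)
  define K where "K = pair_pmf (W r) (pair_pmf (W p) (W r))"
  define J where "J = pair_pmf K (W n)"
  let ?word = "\<lambda>((A, F, B), Y). A \<otimes> (F \<otimes> (B \<otimes> Y))"
  define good where "good = {A. gromov_prod x0 (act f x0) (act (inv A) x0) < R} \<times> ({f} \<times>
      {B. gromov_prod x0 (act (inv f) x0) (act B x0) < R})"
  define bad where "bad = {k. \<not> WPD G act x0 (X \<otimes> ?word k)}"
  \<comment> \<open>The reference point in \<open>H1\<close> does not involve \<open>B\<close>, that
    in \<open>H2\<close> does not involve \<open>A\<close>. Freezing the other factors leaves a
    displacement estimate for an independent walk of length \<open>r\<close>.\<close>
  define H1 where "H1 = {((A, F :: 'a, B), Y). displacement (act (Y \<otimes> X \<otimes> A) x0) (inv B) \<le> C}"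
  define H2 where "H2 = {((A, F :: 'a, B), Y). displacement (act (inv (B \<otimes> Y \<otimes> X)) x0) A \<le> C}"
  have u0: "0 \<le> u" using u[OF X] measure_nonneg order_trans by blast
  have word: "W (r + (p + (r + n))) = map_pmf ?word J"
    unfolding walk_add J_def K_def
    by (simp add: pair_pmf_def map_pmf_def bind_assoc_pmf bind_return_pmf)
  have KG: "A \<in> carrier G \<and> F \<in> carrier G \<and> B \<in> carrier G" if "(A, F, B) \<in> set_pmf K" for A F B
    using that by (auto simp: K_def intro: walk_carrier)
  have cover: "k \<in> (bad \<inter> ((- good) \<times> UNIV)) \<union> (H1 \<union> H2)" if k: "k \<in> set_pmf J" "k \<in> bad" for k
  proof (rule ccontr)
    assume notin: "k \<notin> (bad \<inter> ((- good) \<times> UNIV)) \<union> (H1 \<union> H2)"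
    obtain A F B Y where kk: "k = ((A, F, B), Y)" by (metis surj_pair)
    have G: "A \<in> carrier G" "B \<in> carrier G" "Y \<in> carrier G"
      using k(1) KG[of A F B] by (auto simp: kk J_def intro: walk_carrier)
    have F: "F = f" and gA: "gromov_prod x0 (act f x0) (act (inv A) x0) \<le> R"
      and gB: "gromov_prod x0 (act (inv f) x0) (act B x0) \<le> R"
      using notin k(2) by (auto simp: kk good_def)
    have "WPD G act x0 (X \<otimes> (A \<otimes> (f \<otimes> (B \<otimes> Y))))"
      using notin by (intro WPD_block[OF fG G(1,2) X G(3) \<open>0 \<le> R\<close> C lf fin gB gA])
        (auto simp: kk H1_def H2_def displacement_def)
    then show False using k(2) by (simp add: kk bad_def F)
  qed
  have "measure_pmf.prob (W (r + (p + (r + n)))) {w. \<not> WPD G act x0 (X \<otimes> w)} = measure_pmf.prob J bad"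
    unfolding word by (simp add: vimage_def bad_def)
  also have "\<dots> \<le> measure_pmf.prob J ((bad \<inter> ((- good) \<times> UNIV)) \<union> (H1 \<union> H2))"
    using cover by (rule prob_mono_pmf)
  also have "\<dots> \<le> measure_pmf.prob J (bad \<inter> ((- good) \<times> UNIV)) + (measure_pmf.prob J H1 + measure_pmf.prob J H2)"
    by (intro order_trans[OF measure_Un_le] add_left_mono measure_Un_le) auto
  also have "measure_pmf.prob J H1 \<le> \<beta>"
    unfolding J_def K_def
    by (intro prob_pair_pmf_le' prob_pair_pmf_le order_trans[OF _ disp(2)]) (auto simp: H1_def)
  also have "measure_pmf.prob J H2 \<le> \<beta>"
    unfolding J_def K_def
    by (intro prob_pair_pmf_le') (auto simp: H2_def intro: disp(1))
  also have "measure_pmf.prob J (bad \<inter> ((- good) \<times> UNIV)) \<le> (1 - pmf (W p) f / 4) * u"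
  proof -
    have "measure_pmf.prob J (bad \<inter> ((- good) \<times> UNIV))
       = measure_pmf.expectation K (\<lambda>k. measure_pmf.prob (W n) {Y. (k, Y) \<in> bad \<inter> ((- good) \<times> UNIV)})"
      unfolding J_def by (rule prob_pair_pmf)
    also have "\<dots> \<le> measure_pmf.expectation K (\<lambda>k. u * indicator (- good) k)"
    proof (rule expectation_mono_pmf[where B = 1 and B' = u])
      fix k assume k: "k \<in> set_pmf K"
      obtain A F B where kk: "k = (A, F, B)" by (metis surj_pair)
      note G = KG[OF k[unfolded kk]]
      show "measure_pmf.prob (W n) {Y. (k, Y) \<in> bad \<inter> ((- good) \<times> UNIV)} \<le> u * indicator (- good) k"
      proof (cases "k \<in> good")
        case False
        \<comment> \<open>The bad block joins the left factor; \<open>Y\<close> is independent of it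
          and \<open>u\<close> is uniform in left factors.\<close>
        have "measure_pmf.prob (W n) {Y. (k, Y) \<in> bad \<inter> ((- good) \<times> UNIV)}
          \<le> measure_pmf.prob (W n) {Y. \<not> WPD G act x0 (X \<otimes> (A \<otimes> (F \<otimes> B)) \<otimes> Y)}"
        proof (rule prob_mono_pmf)
          fix Y assume Y: "Y \<in> set_pmf (W n)" "Y \<in> {Y. (k, Y) \<in> bad \<inter> ((- good) \<times> UNIV)}"
          have "X \<otimes> (A \<otimes> (F \<otimes> B)) \<otimes> Y = X \<otimes> (A \<otimes> (F \<otimes> (B \<otimes> Y)))"
            using X G walk_carrier[OF Y(1)] by (simp add: m_assoc)
          then show "Y \<in> {Y. \<not> WPD G act x0 (X \<otimes> (A \<otimes> (F \<otimes> B)) \<otimes> Y)}"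
            using Y(2) by (simp add: bad_def kk)
        qed
        also have "\<dots> \<le> u" using X G by (intro u) simp
        finally show ?thesis using False by simp
      qed simp
    qed (use u0 in \<open>auto simp: indicator_def\<close>)
    also have "\<dots> = u * measure_pmf.prob K (- good)" by simp
    also have "measure_pmf.prob K (- good) = 1 - measure_pmf.prob K good"
      using measure_pmf.prob_compl[of good K] by (simp add: Compl_eq_Diff_UNIV)
    also have "u * (1 - measure_pmf.prob K good) \<le> u * (1 - pmf (W p) f / 4)"
    proof (intro mult_left_mono diff_left_mono u0)
      have half: "1 / 2 \<le> measure_pmf.prob q S" if "measure_pmf.prob q (- S) \<le> 1 / 2" for q and S :: "'a set"
        using that measure_pmf.prob_compl[of S q] by (simp add: Compl_eq_Diff_UNIV)
      define a where "a = measure_pmf.prob (W r) {A. gromov_prod x0 (act f x0) (act (inv A) x0) < R}"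
      define b where "b = measure_pmf.prob (W r) {B. gromov_prod x0 (act (inv f) x0) (act B x0) < R}"
      have a: "1 / 2 \<le> a" unfolding a_def
        using tail(2)[of r "act f x0"] by (intro half) (simp add: Collect_neg_eq[symmetric] not_less)
      have b: "1 / 2 \<le> b" unfolding b_def
        using tail(1)[of r "act (inv f) x0"] by (intro half) (simp add: Collect_neg_eq[symmetric] not_less)
      have "measure_pmf.prob K good = a * (pmf (W p) f * b)"
      proof -
        have prod: "measure_pmf.prob (pair_pmf q q') (S \<times> S') = measure_pmf.prob q S * measure_pmf.prob q' S'"
          for q q' S S'
        proof -
          have "measure_pmf.prob (pair_pmf q q') (S \<times> S')
              = measure_pmf.expectation q (\<lambda>x. measure_pmf.prob q' S' * indicator S x)"
            unfolding prob_pair_pmf by (intro Bochner_Integration.integral_cong) (auto simp: indicator_def)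
          then show ?thesis by simp
        qed
        show ?thesis unfolding K_def good_def prod a_def b_def by (simp add: measure_pmf_single)
      qed
      \<comment> \<open>Each junction avoids its shadow with probability at least 1/2, independently
        of the other and of the middle factor being \<open>f\<close>.\<close>
      moreover have "1 / 2 * (pmf (W p) f * (1 / 2)) \<le> a * (pmf (W p) f * b)"
        using a b by (intro mult_mono) auto
      ultimately show "pmf (W p) f / 4 \<le> measure_pmf.prob K good" by simp
    qed
    finally show ?thesis by (simp add: mult.commute)
  qed
  finally show ?thesis by simp
qed

text \<open>\<open>2 * \<beta> / \<epsilon>\<close> is the fixed point of the affine recursion, so
  errors from all blocks add up to a bound independent of \<open>q\<close>. The remaining
  \<open>s\<close> letters carry only the trivial bound 1.\<close>

lemma not_WPD_iterate:
  assumes rec: "\<And>n u X. (\<And>X. X \<in> carrier G \<Longrightarrow> measure_pmf.prob (W n) {w. \<not> WPD G act x0 (X \<otimes> w)} \<le> u)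
      \<Longrightarrow> X \<in> carrier G \<Longrightarrow>
      measure_pmf.prob (W (l + n)) {w. \<not> WPD G act x0 (X \<otimes> w)} \<le> (1 - \<epsilon>) * u + 2 * \<beta>"
    and "0 < \<epsilon>" "0 \<le> \<beta>" "X \<in> carrier G"
  shows "measure_pmf.prob (W (l * q + s)) {w. \<not> WPD G act x0 (X \<otimes> w)} \<le> (1 - \<epsilon>) ^ q + 2 * \<beta> / \<epsilon>"
  using \<open>X \<in> carrier G\<close>
proof (induction q arbitrary: X)
  case 0
  have "measure_pmf.prob (W (l * 0 + s)) {w. \<not> WPD G act x0 (X \<otimes> w)} \<le> 1" by simp
  also have "1 \<le> (1 - \<epsilon>) ^ 0 + 2 * \<beta> / \<epsilon>" using assms(2,3) by simp
  finally show ?case .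
next
  case (Suc q)
  have "measure_pmf.prob (W (l + (l * q + s))) {w. \<not> WPD G act x0 (X \<otimes> w)}
      \<le> (1 - \<epsilon>) * ((1 - \<epsilon>) ^ q + 2 * \<beta> / \<epsilon>) + 2 * \<beta>"
    by (rule rec) (use Suc in auto)
  also have "\<dots> = (1 - \<epsilon>) ^ Suc q + 2 * \<beta> / \<epsilon>" using assms(2) by (simp add: field_simps)
  finally show ?case by (simp add: add.assoc)
qed

lemma prob_not_WPD_decay:
  assumes h: "h \<in> gen_semigroup G (set_pmf \<mu>)" "WPD G act x0 h"
  shows "\<exists>k p :: nat. \<exists>\<epsilon> \<rho> B. 0 < k \<and> 0 < \<epsilon> \<and> \<epsilon> < 1 \<and> 0 < \<rho> \<and> \<rho> < 1 \<and> 0 < B \<and>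
    (\<forall>t n. measure_pmf.prob (W n) {w. \<not> WPD G act x0 w} \<le> (1 - \<epsilon>) ^ (n div (k * t + p)) + B * \<rho> ^ t)"
proof -
  obtain R where R: "0 \<le> R"
    and tail: "\<And>k z. measure_pmf.prob (W k) {w. R \<le> gromov_prod x0 z (act w x0)} \<le> 1 / 2"
      "\<And>k z. measure_pmf.prob (W k) {w. R \<le> gromov_prod x0 z (act (inv w) x0)} \<le> 1 / 2"
    using shadow_decay_nonneg[of "1 / 2"] by auto
  obtain M :: nat where M: "finite (Stab G act (4 * (R + \<delta>) + 18 * \<delta> + 1) x0 (act (h [^] M) x0))"
      "2 * (R + \<delta>) + 10 * \<delta> + 1 \<le> len (h [^] M)"
    using finite_Stab_pow[OF h(2)] by blast
  obtain p0 where p0: "h \<in> set_pmf (W p0)" using gen_semigroup_walk[OF h(1)] by blast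
  define f where "f = h [^] M"
  define p where "p = p0 * M"
  have f: "f \<in> set_pmf (W p)" unfolding f_def p_def using p0 by (rule walk_pow_mem)
  define C where "C = 2 * (2 * (R + \<delta>) + 10 * \<delta> + 1)"
  obtain k \<rho> where k: "0 < k" "0 < \<rho>" "\<rho> < 1" and d: "\<And>C. \<exists>B>0. \<forall>t z.
     measure_pmf.prob (W (k * t)) {w. displacement z w \<le> C} \<le> B * \<rho> ^ t \<and>
     measure_pmf.prob (W (k * t)) {w. displacement z (inv w) \<le> C} \<le> B * \<rho> ^ t"
    using displacement_decay_both by blast
  obtain B where B: "0 < B"
     "\<And>t z. measure_pmf.prob (W (k * t)) {w. displacement z w \<le> C} \<le> B * \<rho> ^ t"
     "\<And>t z. measure_pmf.prob (W (k * t)) {w. displacement z (inv w) \<le> C} \<le> B * \<rho> ^ t"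
    using d[of C] by blast
  define \<epsilon> where "\<epsilon> = pmf (W p) f / 4"
  have \<epsilon>: "0 < \<epsilon>" "\<epsilon> < 1" using f pmf_le_1[of "W p" f] by (auto simp: \<epsilon>_def pmf_positive)
  have bound: "measure_pmf.prob (W n) {w. \<not> WPD G act x0 w}
      \<le> (1 - \<epsilon>) ^ (n div (2 * k * t + p)) + (2 * B / \<epsilon>) * \<rho> ^ t" for t n
  proof -
    let ?l = "2 * k * t + p"
    have l: "k * t + (p + (k * t + n)) = ?l + n" for n by simp
    have "measure_pmf.prob (W n) {w. \<not> WPD G act x0 w} = measure_pmf.prob (W n) {w. \<not> WPD G act x0 (\<one> \<otimes> w)}"
      by (intro antisym prob_mono_pmf) (auto simp: walk_carrier)
    also have "\<dots> = measure_pmf.prob (W (?l * (n div ?l) + n mod ?l)) {w. \<not> WPD G act x0 (\<one> \<otimes> w)}"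
      by simp
    also have "\<dots> \<le> (1 - \<epsilon>) ^ (n div ?l) + 2 * (B * \<rho> ^ t) / \<epsilon>"
    proof (rule not_WPD_iterate)
      fix n u X
      assume u: "\<And>X. X \<in> carrier G \<Longrightarrow> measure_pmf.prob (W n) {w. \<not> WPD G act x0 (X \<otimes> w)} \<le> u"
        and X: "X \<in> carrier G"
      have "measure_pmf.prob (W (k * t + (p + (k * t + n)))) {w. \<not> WPD G act x0 (X \<otimes> w)}
        \<le> (1 - pmf (W p) f / 4) * u + 2 * (B * \<rho> ^ t)"
        by (rule not_WPD_recursion[OF f R, of C])
           (use M tail B u X in \<open>auto simp: C_def f_def\<close>)
      then show "measure_pmf.prob (W (?l + n)) {w. \<not> WPD G act x0 (X \<otimes> w)} \<le> (1 - \<epsilon>) * u + 2 * (B * \<rho> ^ t)"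
        unfolding l \<epsilon>_def .
    qed (use \<epsilon> k B in auto)
    finally show ?thesis by simp
  qed
  have "0 < 2 * k" "0 < 2 * B / \<epsilon>" using k B \<epsilon> by auto
  then show ?thesis using bound \<epsilon> k by blast
qed

end

text \<open>Blocks of length proportional to \<open>\<surd>n\<close> balance the two terms of the bound.\<close>

lemma sqrt_rate:
  fixes \<phi> :: "nat \<Rightarrow> real" and k p :: nat
  assumes k: "0 < k" and \<epsilon>: "0 < \<epsilon>" "\<epsilon> < 1" and \<rho>: "0 < \<rho>" "\<rho> < 1" and B: "0 < B"
    and bound: "\<And>t n. \<phi> n \<le> (1 - \<epsilon>) ^ (n div (k * t + p)) + B * \<rho> ^ t"
  shows "\<exists>B c. 0 < B \<and> 0 < c \<and> c < 1 \<and> (\<forall>n. \<phi> n \<le> B * c powr sqrt (real n))"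
proof -
  \<comment> \<open>Since \<open>t\<close> is at most the square root of \<open>n\<close>, a block
    has length at most \<open>k + p\<close> times that root, which leaves at least
    \<open>a * sqrt (real n) - 1\<close> blocks.\<close>
  define a where "a = 1 / real (k + p)"
  have a: "0 < a" using k by (simp add: a_def)
  define c1 where "c1 = (1 - \<epsilon>) powr a"
  define c where "c = max c1 \<rho>"
  have c1: "0 < c1" "c1 < 1" using \<epsilon> a powr_less_mono2[of a "1 - \<epsilon>" 1] by (auto simp: c1_def)
  have c: "0 < c" "c < 1" using c1 \<rho> by (auto simp: c_def)
  \<comment> \<open>The two factors pay for rounding down the number of blocks and \<open>t\<close>,
    each a loss of at most 1 in the exponent.\<close>
  define B' where "B' = 1 / (1 - \<epsilon>) + B / \<rho>"
  have B': "0 < B'" using \<epsilon> \<rho> B by (simp add: B'_def add_pos_pos)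
  have "\<phi> n \<le> B' * c powr sqrt (real n)" for n
  proof -
    define t where "t = nat \<lfloor>sqrt (real n)\<rfloor>"
    have t: "real t \<le> sqrt (real n)" "sqrt (real n) - 1 \<le> real t"
    proof -
      have "0 \<le> \<lfloor>sqrt (real n)\<rfloor>" by simp
      then have "real t = of_int \<lfloor>sqrt (real n)\<rfloor>" by (simp add: t_def)
      then show "real t \<le> sqrt (real n)" "sqrt (real n) - 1 \<le> real t" by linarith+
    qed
    define q where "q = n div (k * t + p)"
    have q: "a * sqrt (real n) - 1 \<le> real q"
    proof (cases "n = 0")
      case False
      then have s1: "1 \<le> sqrt (real n)" by simp
      have t0: "0 < t"
      proof -
        have "1 \<le> \<lfloor>sqrt (real n)\<rfloor>" using s1 by (simp add: le_floor_iff)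
        then show ?thesis by (simp add: t_def)
      qed
      have m0: "0 < k * t + p" using k t0 by simp
      have "real (k * t + p) \<le> real k * sqrt (real n) + real p * sqrt (real n)"
        using t(1) s1 mult_left_mono[of "real t" "sqrt (real n)" "real k"]
          mult_left_mono[of 1 "sqrt (real n)" "real p"] by simp
      then have m: "real (k * t + p) \<le> real (k + p) * sqrt (real n)" by (simp add: distrib_right)
      have "n < (q + 1) * (k * t + p)"
        unfolding q_def using m0 by (metis Suc_eq_plus1 dividend_less_times_div mult.commute mult_Suc_right)
      then have "real n < real (q + 1) * real (k * t + p)" by (metis of_nat_less_iff of_nat_mult)
      also have "\<dots> \<le> real (q + 1) * (real (k + p) * sqrt (real n))"
        using m by (intro mult_left_mono) auto
      finally have "sqrt (real n) * sqrt (real n) < (real (q + 1) * real (k + p)) * sqrt (real n)"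
        by (simp add: mult.assoc)
      then have "sqrt (real n) < real (q + 1) * real (k + p)" 
        by (rule mult_right_less_imp_less) (use s1 in simp)
      then show ?thesis using k by (simp add: a_def field_simps)
    qed simp
    have e1: "(1 - \<epsilon>) ^ q \<le> 1 / (1 - \<epsilon>) * c powr sqrt (real n)"
    proof -
      have "(1 - \<epsilon>) ^ q = (1 - \<epsilon>) powr real q" using \<epsilon> by (simp add: powr_realpow)
      also have "\<dots> \<le> (1 - \<epsilon>) powr (a * sqrt (real n) - 1)" using q \<epsilon> by (intro powr_mono') auto
      also have "\<dots> = 1 / (1 - \<epsilon>) * c1 powr sqrt (real n)"
        using \<epsilon> by (simp add: powr_diff c1_def powr_powr)
      also have "\<dots> \<le> 1 / (1 - \<epsilon>) * c powr sqrt (real n)"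
        using \<epsilon> c1 by (intro mult_left_mono powr_mono2) (auto simp: c_def)
      finally show ?thesis .
    qed
    have e2: "B * \<rho> ^ t \<le> B / \<rho> * c powr sqrt (real n)"
    proof -
      have "\<rho> ^ t = \<rho> powr real t" using \<rho> by (simp add: powr_realpow)
      also have "\<dots> \<le> \<rho> powr (sqrt (real n) - 1)" using t \<rho> by (intro powr_mono') auto
      also have "\<dots> = 1 / \<rho> * \<rho> powr sqrt (real n)" using \<rho> by (simp add: powr_diff)
      also have "\<dots> \<le> 1 / \<rho> * c powr sqrt (real n)"
        using \<rho> by (intro mult_left_mono powr_mono2) (auto simp: c_def)
      finally have "B * \<rho> ^ t \<le> B * (1 / \<rho> * c powr sqrt (real n))" using B by (intro mult_left_mono) auto
      then show ?thesis by simp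
    qed
    have "\<phi> n \<le> (1 - \<epsilon>) ^ q + B * \<rho> ^ t" using bound by (simp add: q_def)
    also have "\<dots> \<le> B' * c powr sqrt (real n)" using e1 e2 by (simp add: B'_def distrib_right)
    finally show ?thesis .
  qed
  then show ?thesis using B' c by blast
qed

text \<open>High powers of the two independent loxodromic elements serve as the pair: their mutual
  products are bounded over all exponents, whereas displacement is unbounded.\<close>

lemma (in hyp_walk) schottky_walk_if_non_elementary:
  assumes "non_elementary G act x0 \<mu>"
  shows "schottky_walk G act x0 \<delta> \<mu> L"
proof unfold_locales
  obtain g h where g: "g \<in> gen_semigroup G (set_pmf \<mu>)" "loxodromic G act x0 g"
    and h: "h \<in> gen_semigroup G (set_pmf \<mu>)" "loxodromic G act x0 h"
    and ind: "\<not> (\<exists>s. conv_infty x0 s \<and> bdry_fixes act x0 g s \<and> bdry_fixes act x0 h s)"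
    using assms unfolding non_elementary_def by blast
  have gG: "g \<in> carrier G" "h \<in> carrier G" using g h by (auto simp: loxodromic_carrier)
  obtain p where p: "g \<in> set_pmf (W p)" "0 < p" using gen_semigroup_walk[OF g(1)] by blast
  obtain q where q: "h \<in> set_pmf (W q)" "0 < q" using gen_semigroup_walk[OF h(1)] by blast
  obtain Cg where Cg: "\<And>(n::nat) (m::nat). gromov_prod x0 (act (g [^] n) x0) (act (inv g [^] m) x0) \<le> Cg"
    using loxodromic_gromov_prod_pow_inv[OF g(2)] by blast
  obtain Ch where Ch: "\<And>(n::nat) (m::nat). gromov_prod x0 (act (h [^] n) x0) (act (inv h [^] m) x0) \<le> Ch"
    using loxodromic_gromov_prod_pow_inv[OF h(2)] by blast
  have "\<forall>u\<in>{g, inv g}. \<forall>v\<in>{h, inv h}. \<exists>C. \<forall>(n::nat) (m::nat).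
      gromov_prod x0 (act (u [^] n) x0) (act (v [^] m) x0) \<le> C"
    using independent_cross_bounded[OF g(2) h(2) ind] by blast
  then obtain c where c: "\<And>u v (n::nat) (m::nat). u \<in> {g, inv g} \<Longrightarrow> v \<in> {h, inv h} \<Longrightarrow>
      gromov_prod x0 (act (u [^] n) x0) (act (v [^] m) x0) \<le> c u v"
    by metis
  define C where "C = \<bar>Cg\<bar> + \<bar>Ch\<bar> + (\<Sum>u\<in>{g, inv g}. \<Sum>v\<in>{h, inv h}. \<bar>c u v\<bar>)"
  have sum0: "0 \<le> (\<Sum>u\<in>{g, inv g}. \<Sum>v\<in>{h, inv h}. \<bar>c u v\<bar>)" by (intro sum_nonneg) auto
  have c_le: "c u v \<le> C" if "u \<in> {g, inv g}" "v \<in> {h, inv h}" for u v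
  proof -
    have "\<bar>c u v\<bar> \<le> (\<Sum>v\<in>{h, inv h}. \<bar>c u v\<bar>)" using that by (intro member_le_sum) auto
    also have "\<dots> \<le> (\<Sum>u\<in>{g, inv g}. \<Sum>v\<in>{h, inv h}. \<bar>c u v\<bar>)"
      using that by (intro member_le_sum[of u "{g, inv g}" "\<lambda>u. \<Sum>v\<in>{h, inv h}. \<bar>c u v\<bar>"] sum_nonneg) auto
    finally show ?thesis by (simp add: C_def)
  qed
  show "\<exists>C. \<forall>D. \<exists>j a b. a \<in> set_pmf (W j) \<and> b \<in> set_pmf (W j) \<and> schottky_pair C D a b"
  proof (intro exI[of _ C] allI)
    fix D
    obtain N1 :: nat where N1: "\<forall>n\<ge>N1. D \<le> len (g [^] n)" using loxodromic_len_unbounded[OF g(2)] by blast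
    obtain N2 :: nat where N2: "\<forall>n\<ge>N2. D \<le> len (h [^] n)" using loxodromic_len_unbounded[OF h(2)] by blast
    define k where "k = max N1 N2"
    \<comment> \<open>The exponents are crossed: \<open>g\<close> has word length \<open>p\<close>
      and \<open>h\<close> has word length \<open>q\<close>, so both powers are words of length
      \<open>p * q * k\<close>.\<close>
    have kq: "N1 \<le> q * k" "N2 \<le> p * k" using p(2) q(2) by (auto simp: k_def intro: order_trans[OF _ mult_le_mono1[of 1]])
    define a where "a = g [^] (q * k)"
    define b where "b = h [^] (p * k)"
    have inv_ab: "inv a = inv g [^] (q * k)" "inv b = inv h [^] (p * k)"
      using gG by (simp_all add: a_def b_def nat_pow_inv)
    have "a \<in> set_pmf (W (p * (q * k)))" unfolding a_def using p(1) by (rule walk_pow_mem)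
    moreover have "b \<in> set_pmf (W (p * (q * k)))"
      using walk_pow_mem[OF q(1), of "p * k"] by (simp add: b_def mult.left_commute)
    moreover have "schottky_pair C D a b"
      unfolding schottky_pair_def
    proof (intro conjI)
      show "D \<le> len a" "D \<le> len b" using N1 N2 kq by (auto simp: a_def b_def)
      show "gromov_prod x0 (act a x0) (act (inv a) x0) \<le> C"
        unfolding inv_ab unfolding a_def using Cg[of "q * k" "q * k"] sum0 unfolding C_def by linarith
      show "gromov_prod x0 (act b x0) (act (inv b) x0) \<le> C"
        unfolding inv_ab unfolding b_def using Ch[of "p * k" "p * k"] sum0 unfolding C_def by linarith
      show "\<forall>u\<in>{a, inv a}. \<forall>v\<in>{b, inv b}. gromov_prod x0 (act u x0) (act v x0) \<le> C"
        unfolding inv_ab unfolding a_def b_def using order_trans[OF c c_le] by auto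
    qed
    ultimately show "\<exists>j a b. a \<in> set_pmf (W j) \<and> b \<in> set_pmf (W j) \<and> schottky_pair C D a b"
      by blast
  qed
qed

theorem theorem1p10:
  fixes G :: "('g, 'b) monoid_scheme"
    and act :: "'g \<Rightarrow> 'x::metric_space \<Rightarrow> 'x"
    and x0 :: 'x
    and \<mu> :: "'g pmf"
    and \<delta> :: real
  assumes "group G"
    and "geodesic_space TYPE('x)"
    and "hyperbolic \<delta> TYPE('x)"
    and "isometric_action G act"
    and "set_pmf \<mu> \<subseteq> carrier G"
    and "non_elementary G act x0 \<mu>"
    and "bounded_meas act x0 \<mu>"
    and "WPD_meas G act x0 \<mu>"
  shows "\<exists>B c. B > 0 \<and> 0 < c \<and> c < 1 \<and>
           (\<forall>n. measure_pmf.prob (walk_dist G \<mu> n) {g. WPD G act x0 g}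
                  \<ge> 1 - B * c powr sqrt (real n))"
proof -
  interpret hyp_action G act x0 \<delta>
    using assms by (simp add: hyp_action_def hyp_action_axioms_def)
  obtain L where "\<forall>y\<in>(\<lambda>g. act g x0) ` set_pmf \<mu>. dist x0 y \<le> L"
    using \<open>bounded_meas act x0 \<mu>\<close> bounded_any_center unfolding bounded_meas_def by blast
  then interpret hyp_walk G act x0 \<delta> \<mu> L
    using assms by unfold_locales (auto simp: len_def)
  interpret schottky_walk G act x0 \<delta> \<mu> L
    using \<open>non_elementary G act x0 \<mu>\<close> by (rule schottky_walk_if_non_elementary)
  obtain h where "h \<in> gen_semigroup G (set_pmf \<mu>)" "WPD G act x0 h"
    using \<open>WPD_meas G act x0 \<mu>\<close> unfolding WPD_meas_def by blast
  from prob_not_WPD_decay[OF this] obtain k p :: nat and \<epsilon> \<rho> B where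
    "0 < k" "0 < \<epsilon>" "\<epsilon> < 1" "0 < \<rho>" "\<rho> < 1" "0 < B"
    "\<And>t n. measure_pmf.prob (W n) {w. \<not> WPD G act x0 w} \<le> (1 - \<epsilon>) ^ (n div (k * t + p)) + B * \<rho> ^ t"
    by blast
  from sqrt_rate[OF this] obtain B c where Bc: "0 < B" "0 < c" "c < 1"
    "\<And>n. measure_pmf.prob (W n) {w. \<not> WPD G act x0 w} \<le> B * c powr sqrt (real n)"
    by blast
  have "measure_pmf.prob (W n) {w. WPD G act x0 w} = 1 - measure_pmf.prob (W n) {w. \<not> WPD G act x0 w}" for n
    using measure_pmf.prob_compl[of "{w. \<not> WPD G act x0 w}" "W n"]
    by (simp add: Compl_eq_Diff_UNIV[symmetric] Collect_neg_eq[symmetric])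
  then have "1 - B * c powr sqrt (real n) \<le> measure_pmf.prob (W n) {w. WPD G act x0 w}" for n
    using Bc(4)[of n] by simp
  then show ?thesis using Bc(1-3) by blast
qed

end
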